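(* There exists $\lambda_0>0$ such that the following holds. Fix $\lambda\in(0,\lambda_0]$, assume that $\lambda V^{1/2}>1$ (where $V=2^N$), and let $z_N=z_N(\lambda)$ and $\beta=N^{-1}+\lambda^2$. For $z\in[0,z_N]$, $$[1-O(\beta)]\,\chi_N(z)\;\le\;\mathbb{E}_z^{(N)}L\;\le\;\chi_N(z).$$ In particular, at the critical value, $$\mathbb{E}_{z_N}^{(N)}L=\lambda V^{1/2}[1+O(\beta)].$$ Here $O(\beta)$ denotes a quantity bounded in absolute value by $C\beta$ with a constant $C$ independent of $N$, $z$ and $\lambda\in(0,\lambda_0]$.
   Context: For a positive integer $N$, $\mathbb{Q}^N=\mathbb{Z}_2^N$ is the $N$-dimensional hypercube (binary strings of length $N$, with coordinatewise addition mod 2), $V=V(N)=2^N$, and $|x|$ is the number of coordinates of $x\in\mathbb{Q}^N$ equal to 1. An $n$-step self-avoiding walk is a function $\omega:\{0,\dots,n\}\to\mathbb{Q}^N$ with $|\omega(i)-\omega(i-1)|=1$ for $1\le i\le n$ and $\omega(i)\ne\omega(j)$ for $i\neq j$. $c_n^{(N)}$ is the number of $n$-step self-avoiding walks with $\omega(0)=0$, with $c_0^{(N)}=1$. The susceptibility is the polynomial $\chi_N(z)=\sum_{n=0}^{V-1}c_n^{(N)}z^n$. For $\lambda>0$ with $\lambda V^{1/2}>1$, the critical value $z_N=z_N(\lambda)>0$ is the unique positive solution of $\chi_N(z_N)=\lambda V^{1/2}$. For $z\ge0$, the length $L$ is the random variable with $\mathbb{P}_z^{(N)}(L=n+1)=\frac{1}{\chi_N(z)}c_n^{(N)}z^n$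 for integers $n\ge0$, and its expectation is $\mathbb{E}_z^{(N)}L=\sum_{n\ge0}(n+1)\mathbb{P}_z^{(N)}(L=n+1)=\frac{1}{\chi_N(z)}\frac{d}{dz}[z\chi_N(z)]$. *)

theory Defs
  imports "HOL-Probability.Probability" "HOL-Library.Z2" "HOL-Library.Function_Algebras"
begin

text \<open>
  The group \<open>\<int>\<^sub>2\<^sup>N\<close> is realised inside the group \<open>nat \<Rightarrow> bit\<close> (pointwise addition mod 2, zero
  function as origin): coordinates are indexed by \<open>{..<N}\<close>, and the irrelevant values at indices
  \<open>i \<ge> N\<close> are fixed to 0, so that each binary string of length \<open>N\<close> has exactly one representative.
\<close>

definition cube :: "nat \<Rightarrow> (nat \<Rightarrow> bit) set" where
  "cube N = {x. \<forall>i\<ge>N. x i = 0}"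

definition vol :: "nat \<Rightarrow> nat" where
  "vol N = 2 ^ N"

definition weight :: "nat \<Rightarrow> (nat \<Rightarrow> bit) \<Rightarrow> nat" where
  "weight N x = card {i. i < N \<and> x i = 1}"

text \<open>
  Walks are extensional functions on \<open>{0..n}\<close> (hence \<open>\<rightarrow>\<^sub>E\<close>), so that counting these functions
  really counts walks.
\<close>

definition saws :: "nat \<Rightarrow> nat \<Rightarrow> (nat \<Rightarrow> nat \<Rightarrow> bit) set" where
  "saws N n = {\<omega> \<in> {0..n} \<rightarrow>\<^sub>E cube N.
     (\<forall>i\<in>{1..n}. weight N (\<omega> i - \<omega> (i - 1)) = 1) \<and>
     (\<forall>i\<in>{0..n}. \<forall>j\<in>{0..n}. i \<noteq> j \<longrightarrow> \<omega> i \<noteq> \<omega> j)}"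

definition saw_count :: "nat \<Rightarrow> nat \<Rightarrow> nat" where
  "saw_count N n = card {\<omega> \<in> saws N n. \<omega> 0 = 0}"

definition susceptibility :: "nat \<Rightarrow> real \<Rightarrow> real" where
  "susceptibility N z = (\<Sum>n = 0..vol N - 1. real (saw_count N n) * z ^ n)"

text \<open>
  See \<open>z_crit_ex1\<close> below for existence and uniqueness when \<open>N > 0\<close> and \<open>lam V\<^sup>1\<^sup>/\<^sup>2 > 1\<close>.
\<close>

definition z_crit :: "nat \<Rightarrow> real \<Rightarrow> real" where
  "z_crit N lam = (THE z. z > 0 \<and> susceptibility N z = lam * sqrt (real (vol N)))"

text \<open>
  The law of the length \<open>L\<close>. The weights form a probability mass function
  for every \<open>z \<ge> 0\<close> (lemma \<open>pmf_length\<close>).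
\<close>

definition length_pmf :: "nat \<Rightarrow> real \<Rightarrow> nat pmf" where
  "length_pmf N z = embed_pmf (\<lambda>m. case m of
     0 \<Rightarrow> 0
   | Suc n \<Rightarrow> real (saw_count N n) * z ^ n / susceptibility N z)"

definition expected_length :: "nat \<Rightarrow> real \<Rightarrow> real" where
  "expected_length N z = measure_pmf.expectation (length_pmf N z) real"

lemma bit_UNIV: "(UNIV :: bit set) = {0, 1}"
  using bit.exhaust by auto

lemma bij_cube: "bij_betw (\<lambda>x. restrict x {..<N}) (cube N) ({..<N} \<rightarrow>\<^sub>E (UNIV :: bit set))"
proof -
  define g where "g = (\<lambda>(y :: nat \<Rightarrow> bit) (i :: nat). if i < N then y i else (0 :: bit))"
  have g_cube: "g y \<in> cube N" for y by (simp add: g_def cube_def)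
  have g_restrict: "g (restrict x {..<N}) = x" if "x \<in> cube N" for x
    using that by (auto simp: g_def cube_def fun_eq_iff)
  have restrict_g: "restrict (g y) {..<N} = y" if "y \<in> {..<N} \<rightarrow>\<^sub>E (UNIV :: bit set)" for y
  proof
    fix i
    show "restrict (g y) {..<N} i = y i"
      using PiE_arb[OF that, of i] by (cases "i < N") (simp_all add: g_def)
  qed
  have maps: "restrict x {..<N} \<in> {..<N} \<rightarrow>\<^sub>E (UNIV :: bit set)" for x
    unfolding restrict_PiE_iff by (intro ballI UNIV_I)
  show ?thesis
    using g_cube g_restrict restrict_g maps
    by (intro bij_betw_byWitness[where f' = g] ballI image_subsetI)
qed

lemma card_cube: "card (cube N) = vol N"
proof -
  have "card (UNIV :: bit set) = 2" unfolding bit_UNIV by simp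
  then show ?thesis
    using bij_betw_same_card[OF bij_cube[of N]] by (simp add: card_PiE vol_def)
qed

lemma finite_cube: "finite (cube N)"
  by (rule card_ge_0_finite) (simp add: card_cube vol_def)

lemma finite_saws: "finite (saws N n)"
proof (rule finite_subset)
  show "saws N n \<subseteq> {0..n} \<rightarrow>\<^sub>E cube N" by (auto simp: saws_def)
  show "finite ({0..n} \<rightarrow>\<^sub>E cube N)" by (intro finite_PiE finite_cube) auto
qed

lemma saw_count_0: "saw_count N 0 = 1"
proof -
  have "{\<omega> \<in> saws N 0. \<omega> 0 = 0} = {\<lambda>i. if i = 0 then 0 else undefined}"
    by (auto simp: saws_def PiE_def extensional_def cube_def fun_eq_iff)
  then show ?thesis by (simp add: saw_count_def)
qed

lemma saw_count_ge_vol: assumes "n \<ge> vol N" shows "saw_count N n = 0"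
proof -
  have "saws N n = {}"
  proof (rule ccontr)
    assume "saws N n \<noteq> {}"
    then obtain w where w: "w \<in> saws N n" by auto
    have "inj_on w {0..n}" "w ` {0..n} \<subseteq> cube N"
      using w by (fastforce simp: saws_def inj_on_def)+
    then have "card {0..n} \<le> card (cube N)"
      using card_inj_on_le finite_cube by blast
    then show False using assms card_cube by simp
  qed
  then show ?thesis by (simp add: saw_count_def)
qed

lemma saw_count_1: assumes "N > 0" shows "saw_count N 1 > 0"
proof -
  define e :: "nat \<Rightarrow> bit" where "e = (\<lambda>i. if i = 0 then 1 else 0)"
  define w where "w = (\<lambda>k::nat. if k = 0 then 0 else if k = 1 then e else undefined)"
  have s: "{i. i < N \<and> e i = 1} = {0}" using assms by (auto simp: e_def)
  have d: "e \<noteq> 0" by (auto simp: e_def fun_eq_iff)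
  have "{0..1::nat} = {0, 1}" by auto
  moreover have "w \<in> {0, 1} \<rightarrow>\<^sub>E cube N"
    using assms by (auto simp: w_def PiE_def extensional_def cube_def e_def)
  moreover have "weight N (w 1 - w (1 - 1)) = 1" by (simp add: w_def weight_def s)
  moreover have "w 0 \<noteq> w 1" using d by (auto simp: w_def)
  ultimately have "w \<in> saws N 1" unfolding saws_def by simp
  moreover have "w 0 = 0" by (simp add: w_def)
  ultimately show ?thesis
    unfolding saw_count_def using finite_saws[of N 1] by (auto simp: card_gt_0_iff)
qed

lemma vol_pos: "vol N > 0"
  by (simp add: vol_def)

lemma susceptibility_0: "susceptibility N 0 = 1"
  unfolding susceptibility_def by (subst sum.atLeast_Suc_atMost) (auto simp: saw_count_0)

lemma susceptibility_ge:
  assumes "N > 0" "0 \<le> x" "x \<le> y"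
  shows "susceptibility N x + (y - x) \<le> susceptibility N y"
proof -
  have V: "1 \<in> {0..vol N - 1}"
    using assms(1) power_increasing[of 1 N "2::nat"] by (auto simp: vol_def)
  have "y - x \<le> real (saw_count N 1) * (y - x)"
    using saw_count_1[OF assms(1)] assms(3)
    by (intro mult_le_cancel_right1[THEN iffD2]) (auto simp: Suc_le_eq)
  also have "\<dots> = real (saw_count N 1) * (y ^ 1 - x ^ 1)" by simp
  also have "\<dots> \<le> (\<Sum>n = 0..vol N - 1. real (saw_count N n) * (y ^ n - x ^ n))"
    by (rule member_le_sum[OF V]) (use assms in \<open>auto intro!: mult_nonneg_nonneg power_mono\<close>)
  also have "\<dots> = susceptibility N y - susceptibility N x"
    by (simp add: susceptibility_def sum_subtractf right_diff_distrib)
  finally show ?thesis by simp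
qed

lemma z_crit_ex1:
  assumes "N > 0" "lam * sqrt (real (vol N)) > 1"
  shows "\<exists>!z. z > 0 \<and> susceptibility N z = lam * sqrt (real (vol N))"
proof -
  let ?t = "lam * sqrt (real (vol N))"
  have "\<exists>z\<ge>0. z \<le> ?t \<and> susceptibility N z = ?t"
  proof (rule IVT')
    show "susceptibility N 0 \<le> ?t" using assms by (simp add: susceptibility_0)
    show "?t \<le> susceptibility N ?t"
      using susceptibility_ge[of N 0 ?t] assms by (simp add: susceptibility_0)
    show "0 \<le> ?t" using assms by linarith
    show "continuous_on {0..?t} (susceptibility N)"
      unfolding susceptibility_def by (intro continuous_intros)
  qed
  then obtain z where z: "z \<ge> 0" "susceptibility N z = ?t" by blast
  have "z \<noteq> 0" using z assms susceptibility_0 by force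
  show ?thesis
  proof (rule ex1I[of _ z])
    show "z > 0 \<and> susceptibility N z = ?t" using z \<open>z \<noteq> 0\<close> by auto
    fix y assume y: "y > 0 \<and> susceptibility N y = ?t"
    then show "y = z"
      using susceptibility_ge[of N y z] susceptibility_ge[of N z y] z assms by linarith
  qed
qed

lemma susceptibility_pos: assumes "z \<ge> 0" shows "susceptibility N z > 0"
proof -
  have "0 < real (saw_count N 0) * z ^ 0" by (simp add: saw_count_0)
  also have "\<dots> \<le> susceptibility N z" unfolding susceptibility_def
    by (rule member_le_sum) (use assms in auto)
  finally show ?thesis .
qed

lemma pmf_length:
  assumes "z \<ge> 0"
  shows "pmf (length_pmf N z) m =
    (case m of 0 \<Rightarrow> 0 | Suc n \<Rightarrow> real (saw_count N n) * z ^ n / susceptibility N z)"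
  unfolding length_pmf_def
proof (rule pmf_embed_pmf)
  let ?f = "\<lambda>m. case m of 0 \<Rightarrow> 0
    | Suc n \<Rightarrow> real (saw_count N n) * z ^ n / susceptibility N z"
  note pos = susceptibility_pos[OF assms, of N]
  show nn: "0 \<le> ?f m" for m using assms pos by (cases m) auto
  have "(\<integral>\<^sup>+ m. ennreal (?f m) \<partial>count_space UNIV) = (\<Sum>m\<in>{1..vol N}. ennreal (?f m))"
  proof (rule nn_integral_count_space')
    fix m assume "m \<notin> {1..vol N}"
    then show "ennreal (?f m) = 0" by (cases m) (auto simp: saw_count_ge_vol)
  qed auto
  also have "\<dots> = ennreal (\<Sum>m\<in>{1..vol N}. ?f m)" using nn by (intro sum_ennreal) auto
  also have "(\<Sum>m\<in>{1..vol N}. ?f m) = (\<Sum>n = 0..vol N - 1. ?f (Suc n))"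
    using sum.shift_bounds_cl_Suc_ivl[of ?f 0 "vol N - 1"] vol_pos[of N] by simp
  also have "\<dots> = susceptibility N z / susceptibility N z"
    by (simp only: susceptibility_def sum_divide_distrib nat.case)
  also have "\<dots> = 1" using pos by simp
  finally show "(\<integral>\<^sup>+ m. ennreal (?f m) \<partial>count_space UNIV) = 1" by simp
qed

lemma expected_length_sum:
  assumes "z \<ge> 0"
  shows "expected_length N z =
    (\<Sum>n = 0..vol N - 1. real (n + 1) * (real (saw_count N n) * z ^ n)) / susceptibility N z"
proof -
  have sub: "set_pmf (length_pmf N z) \<subseteq> {1..vol N}"
  proof
    fix m assume "m \<in> set_pmf (length_pmf N z)"
    then have nz: "pmf (length_pmf N z) m \<noteq> 0" by (simp add: set_pmf_iff)
    then obtain n where n: "m = Suc n" using pmf_length[OF assms, of N 0] by (cases m) auto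
    have "saw_count N n \<noteq> 0" using nz by (auto simp: n pmf_length[OF assms])
    then have "n < vol N" using saw_count_ge_vol[of N n] by linarith
    then show "m \<in> {1..vol N}" by (simp add: n)
  qed
  have "expected_length N z = (\<Sum>m\<in>{1..vol N}. real m * pmf (length_pmf N z) m)"
    unfolding expected_length_def by (rule integral_measure_pmf_real) (use sub in auto)
  also have "\<dots> = (\<Sum>n = 0..vol N - 1. real (Suc n) * pmf (length_pmf N z) (Suc n))"
    using sum.shift_bounds_cl_Suc_ivl[of "\<lambda>m. real m * pmf (length_pmf N z) m" 0 "vol N - 1"]
      vol_pos[of N] by simp
  finally show ?thesis by (simp add: pmf_length[OF assms] sum_divide_distrib)
qed

lemma expected_length_deriv:
  assumes "z \<ge> 0"
  shows "expected_length N z = deriv (\<lambda>z. z * susceptibility N z) z / susceptibility N z"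
proof -
  have "((\<lambda>z. \<Sum>n = 0..vol N - 1. real (saw_count N n) * z ^ Suc n) has_real_derivative
      (\<Sum>n = 0..vol N - 1. real (n + 1) * (real (saw_count N n) * z ^ n))) (at z)"
    by (auto intro!: derivative_eq_intros sum.cong simp del: power_Suc)
  also have "(\<lambda>z. \<Sum>n = 0..vol N - 1. real (saw_count N n) * z ^ Suc n) =
      (\<lambda>z. z * susceptibility N z)"
    by (simp add: susceptibility_def sum_distrib_left mult_ac fun_eq_iff)
  finally show ?thesis
    by (simp add: DERIV_imp_deriv expected_length_sum[OF assms])
qed

end

theory Submission
  imports Defs "HOL-Real_Asymp.Real_Asymp"
begin

text \<open>
  Write \<open>G(x)\<close> for the two-point function and \<open>chi\<close> for the susceptibility. Concatenating two walks
  gives \<open>d(z chi)/dz <= chi\<^sup>2\<close>, and the pairs lost to intersections cost at most a factor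
  \<open>1 - \<Sum>\<^sub>x G(x)\<^sup>2\<close> with the sum over \<open>x \<noteq> 0\<close>. So it suffices to bound this bubble by \<open>O(1/N + lam\<^sup>2)\<close>.

  No lace expansion is needed. After \<open>m ~ N\<^sup>5\<^sup>/\<^sup>4\<close> steps the non-backtracking walk is uniform on the cube up
  to a constant factor, while it is still self-avoiding with probability close to 1, because a
  non-backtracking step closes a loop with probability \<open>O(1/N\<^sup>2)\<close> only. Splitting off the first \<open>m\<close>
  steps bounds the part of \<open>G(x)\<close> from walks longer than \<open>m\<close> by \<open>O(c_m z^m) chi / V\<close>, so if
  \<open>c_m z^m\<close> is bounded, the bubble is at most \<open>O(1/N) + O(chi\<^sup>2 / V)\<close>. Conversely, if \<open>c_m z^m <= 3\<close>
  then a walk of length \<open>m\<close> rarely meets an independent walk weighted by \<open>z\<close>, and comparing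
  \<open>\<Sum>\<^sub>n c_(m+n) z^(m+n) <= chi\<close> with \<open>c_m z^m chi\<close> improves the bound to \<open>c_m z^m <= 3/2\<close>. By
  continuity in \<open>z\<close> the bound holds as long as \<open>chi <= V\<^sup>1\<^sup>/\<^sup>2\<close>.
\<close>

section \<open>Self-avoiding paths as lists\<close>

definition adj :: "nat \<Rightarrow> (nat \<Rightarrow> bit) \<Rightarrow> (nat \<Rightarrow> bit) \<Rightarrow> bool" where
  "adj N x y \<longleftrightarrow> weight N (y - x) = 1"

definition spath :: "nat \<Rightarrow> (nat \<Rightarrow> bit) list \<Rightarrow> bool" where
  "spath N xs \<longleftrightarrow> set xs \<subseteq> cube N \<and> successively (adj N) xs \<and> distinct xs"

text \<open>Lists replace extensional functions so that cutting, reversing and translating a walk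
  become \<open>take\<close>, \<open>drop\<close>, \<open>rev\<close> and
  \<open>map\<close>.\<close>

definition paths :: "nat \<Rightarrow> nat \<Rightarrow> (nat \<Rightarrow> bit) \<Rightarrow> (nat \<Rightarrow> bit) list set" where
  "paths N n x = {xs. length xs = Suc n \<and> xs ! 0 = x \<and> spath N xs}"

definition paths_to :: "nat \<Rightarrow> nat \<Rightarrow> (nat \<Rightarrow> bit) \<Rightarrow> (nat \<Rightarrow> bit) \<Rightarrow> (nat \<Rightarrow> bit) list set" where
  "paths_to N n x y = {xs \<in> paths N n x. xs ! n = y}"

definition saw_num_to :: "nat \<Rightarrow> nat \<Rightarrow> (nat \<Rightarrow> bit) \<Rightarrow> real" where
  "saw_num_to N n y = real (card (paths_to N n 0 y))"

definition saw_num :: "nat \<Rightarrow> nat \<Rightarrow> real" where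
  "saw_num N n = real (saw_count N n)"

section \<open>Arithmetic modulo 2 and translation invariance\<close>

lemma minus_eq_plus: "x - y = x + (y :: nat \<Rightarrow> bit)"
  by (simp add: fun_eq_iff)

lemma add_self: "x + x = (0 :: nat \<Rightarrow> bit)"
  by (simp add: fun_eq_iff)

lemma add_self_left: "x + (x + z) = (z :: nat \<Rightarrow> bit)"
  by (simp add: add_self flip: add.assoc)

lemma cube_add: "x \<in> cube N \<Longrightarrow> y \<in> cube N \<Longrightarrow> x + y \<in> cube N"
  by (auto simp: cube_def)

lemma cube_diff: "x \<in> cube N \<Longrightarrow> y \<in> cube N \<Longrightarrow> x - y \<in> cube N"
  by (auto simp: cube_def)

lemma zero_cube: "0 \<in> cube N"
  by (auto simp: cube_def)

lemma adj_translate: "adj N (a + x) (a + y) = adj N x y"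
  by (simp add: adj_def)

lemma adj_sym: "adj N x y = adj N y x"
  by (simp add: adj_def minus_eq_plus add.commute)

lemma spath_translate:
  assumes "a \<in> cube N" "spath N xs"
  shows "spath N (map ((+) a) xs)"
  using assms
  by (auto simp: spath_def adj_translate successively_map distinct_map inj_on_def intro: cube_add)

lemma spath_rev: "spath N (rev xs) = spath N xs"
proof -
  have "(\<lambda>x y. adj N y x) = adj N" by (intro ext) (rule adj_sym)
  then show ?thesis unfolding spath_def by (simp only: successively_rev set_rev distinct_rev)
qed

lemma finite_paths: "finite (paths N n x)"
proof (rule finite_subset)
  show "paths N n x \<subseteq> {xs. set xs \<subseteq> cube N \<and> length xs = Suc n}"
    by (auto simp: paths_def spath_def)
qed (simp add: finite_lists_length_eq finite_cube)

lemma finite_paths_to: "finite (paths_to N n x y)"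
  by (simp add: paths_to_def finite_paths)

lemma paths_translate:
  assumes "a \<in> cube N" "xs \<in> paths N n x"
  shows "map ((+) a) xs \<in> paths N n (a + x)"
  using assms spath_translate[of a N xs] by (auto simp: paths_def)

text \<open>Translation by \<open>x\<close> is an involution because \<open>x + x = 0\<close>, so it
  serves as its own inverse.\<close>

lemma card_paths_translate:
  assumes "x \<in> cube N"
  shows "card (paths N n x) = card (paths N n 0)"
proof -
  have "bij_betw (map ((+) x)) (paths N n 0) (paths N n x)"
  proof (rule bij_betw_byWitness[where f' = "map ((+) x)"])
    have *: "map ((+) x) (map ((+) x) xs) = xs" for xs
      by (simp add: map_idI add_self_left)
    show "\<forall>a\<in>paths N n 0. map ((+) x) (map ((+) x) a) = a"
      "\<forall>a\<in>paths N n x. map ((+) x) (map ((+) x) a) = a" using * by auto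
    show "map ((+) x) ` paths N n 0 \<subseteq> paths N n x"
      using paths_translate[OF assms, of _ n 0] by auto
    have "x + x = 0" by (rule add_self)
    then show "map ((+) x) ` paths N n x \<subseteq> paths N n 0"
      using paths_translate[OF assms, of _ n x] by auto
  qed
  then show ?thesis using bij_betw_same_card by fastforce
qed

lemma card_paths_to_translate:
  assumes "x \<in> cube N"
  shows "real (card (paths_to N n x y)) = saw_num_to N n (y - x)"
proof -
  have "bij_betw (map ((+) x)) (paths_to N n 0 (y - x)) (paths_to N n x y)"
  proof (rule bij_betw_byWitness[where f' = "map ((+) x)"])
    have *: "map ((+) x) (map ((+) x) xs) = xs" for xs
      by (simp add: map_idI add_self_left)
    show "\<forall>a\<in>paths_to N n 0 (y - x). map ((+) x) (map ((+) x) a) = a"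
      "\<forall>a\<in>paths_to N n x y. map ((+) x) (map ((+) x) a) = a" using * by auto
    show "map ((+) x) ` paths_to N n 0 (y - x) \<subseteq> paths_to N n x y"
      using paths_translate[OF assms, of _ n 0]
      by (auto simp: paths_to_def paths_def)
    have "x + x = 0" by (rule add_self)
    then show "map ((+) x) ` paths_to N n x y \<subseteq> paths_to N n 0 (y - x)"
      using paths_translate[OF assms, of _ n x]
      by (auto simp: paths_to_def paths_def minus_eq_plus add.commute)
  qed
  then show ?thesis using bij_betw_same_card unfolding saw_num_to_def by fastforce
qed

text \<open>The link to the function-based count: listing the values of a walk and indexing a list
  on \<open>{0..n}\<close> are mutually inverse.\<close>

lemma saw_num_eq: "saw_num N n = real (card (paths N n 0))"
proof -
  have "bij_betw (\<lambda>w. map w [0..<Suc n]) {w \<in> saws N n. w 0 = 0} (paths N n 0)"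
  proof (rule bij_betw_byWitness[where f' = "\<lambda>xs. restrict (\<lambda>i. xs ! i) {0..n}"])
    show "\<forall>a\<in>{w \<in> saws N n. w 0 = 0}. restrict (\<lambda>i. map a [0..<Suc n] ! i) {0..n} = a"
    proof
      fix a assume "a \<in> {w \<in> saws N n. w 0 = 0}"
      then have a: "a \<in> {0..n} \<rightarrow>\<^sub>E cube N" by (auto simp: saws_def)
      show "restrict (\<lambda>i. map a [0..<Suc n] ! i) {0..n} = a"
      proof
        fix i show "restrict (\<lambda>i. map a [0..<Suc n] ! i) {0..n} i = a i"
          using PiE_arb[OF a, of i] by (auto simp: nth_append less_Suc_eq_le simp del: upt_Suc)
      qed
    qed
    show "\<forall>a'\<in>paths N n 0. map (restrict ((!) a') {0..n}) [0..<Suc n] = a'"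
      by (auto simp: paths_def intro!: nth_equalityI simp del: upt_Suc)
    show "(\<lambda>w. map w [0..<Suc n]) ` {w \<in> saws N n. w 0 = 0} \<subseteq> paths N n 0"
    proof clarify
      fix w :: "nat \<Rightarrow> nat \<Rightarrow> bit" assume w: "w \<in> saws N n" "w 0 = 0"
      have "adj N (w i) (w (Suc i))" if "i < n" for i
        using w that by (auto simp: saws_def adj_def dest!: bspec[of _ _ "Suc i"])
      moreover have "inj_on w {0..<Suc n}" using w by (fastforce simp: saws_def inj_on_def)
      moreover have "w ` {0..<Suc n} \<subseteq> cube N" using w by (fastforce simp: saws_def)
      ultimately show "map w [0..<Suc n] \<in> paths N n 0" using w(2)
        by (auto simp: paths_def spath_def successively_conv_nth distinct_map simp del: upt_Suc)
    qed
    show "(\<lambda>xs. restrict (\<lambda>i. xs ! i) {0..n}) ` paths N n 0 \<subseteq> {w \<in> saws N n. w 0 = 0}"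
    proof clarify
      fix xs assume xs: "xs \<in> paths N n 0"
      have "adj N (xs ! (i - 1)) (xs ! i)" if "i \<in> {1..n}" for i
        using xs that successively_nth[of "adj N" xs "i - 1"]
        by (auto simp: paths_def spath_def)
      moreover have "xs ! i \<in> cube N" if "i \<le> n" for i
        using xs that nth_mem[of i xs] by (auto simp: paths_def spath_def)
      ultimately show "restrict (\<lambda>i. xs ! i) {0..n} \<in> saws N n \<and> restrict (\<lambda>i. xs ! i) {0..n} 0 = 0"
        using xs
        by (auto simp: paths_def spath_def saws_def adj_def nth_eq_iff_index_eq less_Suc_eq_le)
    qed
  qed
  then show ?thesis unfolding saw_num_def saw_count_def using bij_betw_same_card by fastforce
qed

lemma paths_to_cube: "xs \<in> paths_to N n x y \<Longrightarrow> y \<in> cube N"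
  by (auto simp: paths_to_def paths_def spath_def)

lemma saw_num_eq_sum: "saw_num N n = (\<Sum>y\<in>cube N. saw_num_to N n y)"
proof -
  have "paths N n 0 = (\<Union>y\<in>cube N. paths_to N n 0 y)"
    using paths_to_cube[of _ N n 0] by (fastforce simp: paths_to_def paths_def spath_def)
  moreover have "card (\<Union>y\<in>cube N. paths_to N n 0 y) = (\<Sum>y\<in>cube N. card (paths_to N n 0 y))"
    by (rule card_UN_disjoint) (auto simp: finite_cube finite_paths_to, auto simp: paths_to_def)
  ultimately have "card (paths N n 0) = (\<Sum>y\<in>cube N. card (paths_to N n 0 y))"
    by simp
  then show ?thesis by (simp add: saw_num_eq saw_num_to_def)
qed

lemma saw_num_to_nonneg: "saw_num_to N n y \<ge> 0" by (simp add: saw_num_to_def)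
lemma saw_num_nonneg: "saw_num N n \<ge> 0" by (simp add: saw_num_def)

lemma saw_num_to_outside: "y \<notin> cube N \<Longrightarrow> saw_num_to N n y = 0"
  using paths_to_cube[of _ N n 0 y] by (force simp: saw_num_to_def)

section \<open>Cutting and joining walks\<close>

lemma split_path:
  assumes "xs \<in> paths N n x" "i \<le> n"
  shows "take (Suc i) xs \<in> paths_to N i x (xs ! i)" "drop i xs \<in> paths N (n - i) (xs ! i)"
proof -
  have "successively (adj N) (take (Suc i) xs)" "successively (adj N) (drop i xs)"
    using assms by (auto simp: paths_def spath_def successively_conv_nth)
  moreover have "set (take (Suc i) xs) \<subseteq> cube N" "set (drop i xs) \<subseteq> cube N"
    using assms set_take_subset[of "Suc i" xs] set_drop_subset[of i xs]
    by (auto simp: paths_def spath_def)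
  ultimately show "take (Suc i) xs \<in> paths_to N i x (xs ! i)" "drop i xs \<in> paths N (n - i) (xs ! i)"
    using assms by (auto simp: paths_to_def paths_def spath_def)
qed

lemma split_inj:
  assumes "take (Suc i) xs = take (Suc i) ys" "drop i xs = drop i ys"
  shows "xs = ys"
proof -
  have "take i xs = take i ys" using arg_cong[OF assms(1), of "take i"] by (simp add: min_def)
  then show ?thesis using assms(2) by (metis append_take_drop_id)
qed

text \<open>Cut at time \<open>m\<close>: both pieces are self-avoiding, and forgetting that they
  also avoid each other leaves an upper bound. The second piece starts at \<open>y\<close> and is
  translated back to the origin.\<close>

lemma saw_num_to_submult:
  "saw_num_to N (m + n) x \<le> (\<Sum>y\<in>cube N. saw_num_to N m y * saw_num_to N n (x - y))"
proof -
  define A where "A = (SIGMA y:cube N. paths_to N m 0 y \<times> paths_to N n y x)"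
  define f where "f = (\<lambda>xs :: (nat \<Rightarrow> bit) list. (xs ! m, (take (Suc m) xs, drop m xs)))"
  have "inj_on f (paths_to N (m+n) 0 x)"
    by (rule inj_onI) (auto simp: f_def intro: split_inj)
  moreover have "f ` paths_to N (m+n) 0 x \<subseteq> A"
  proof (rule image_subsetI)
    fix xs assume xs: "xs \<in> paths_to N (m+n) 0 x"
    then have p: "xs \<in> paths N (m+n) 0" and l: "xs ! (m+n) = x" by (auto simp: paths_to_def)
    have "drop m xs \<in> paths_to N n (xs ! m) x"
      using split_path(2)[OF p, of m] l p by (auto simp: paths_to_def paths_def)
    then show "f xs \<in> A"
      using split_path(1)[OF p, of m] paths_to_cube by (auto simp: A_def f_def)
  qed
  moreover have "finite A" by (auto simp: A_def finite_cube finite_paths_to)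
  ultimately have "card (paths_to N (m+n) 0 x) \<le> card A" by (rule card_inj_on_le)
  then have "saw_num_to N (m+n) x \<le> real (card A)" by (simp add: saw_num_to_def)
  also have "\<dots> = (\<Sum>y\<in>cube N. saw_num_to N m y * real (card (paths_to N n y x)))"
    by (simp add: A_def card_SigmaI finite_cube finite_paths_to card_cartesian_product saw_num_to_def)
  also have "\<dots> = (\<Sum>y\<in>cube N. saw_num_to N m y * saw_num_to N n (x - y))"
    by (intro sum.cong refl) (simp add: card_paths_to_translate)
  finally show ?thesis .
qed

lemma saw_num_submult: "saw_num N (m + n) \<le> saw_num N m * saw_num N n"
proof -
  have "card (paths N (m+n) 0) \<le> card (SIGMA xs:paths N m 0. paths N n (xs ! m))"
  proof (rule card_inj_on_le)
    show "inj_on (\<lambda>xs. (take (Suc m) xs, drop m xs)) (paths N (m+n) 0)"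
      by (rule inj_onI) (auto intro: split_inj)
    show "(\<lambda>xs. (take (Suc m) xs, drop m xs)) ` paths N (m+n) 0 \<subseteq> (SIGMA xs:paths N m 0. paths N n (xs ! m))"
      using split_path[of _ N "m+n" 0 m] by (force simp: paths_to_def)
  qed (auto simp: finite_paths)
  also have "\<dots> = (\<Sum>xs\<in>paths N m 0. card (paths N n (xs ! m)))"
    by (simp add: finite_paths)
  also have "\<dots> = (\<Sum>xs\<in>paths N m 0. card (paths N n 0))"
    by (intro sum.cong refl card_paths_translate) (auto simp: paths_def spath_def)
  finally have "real (card (paths N (m+n) 0)) \<le> real (card (paths N m 0) * card (paths N n 0))"
    unfolding of_nat_le_iff by simp
  then show ?thesis by (simp add: saw_num_eq)
qed

text \<open>Bounds the number of walks through \<open>x\<close> by splitting them at \<open>x\<close>.\<close>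

definition hit :: "nat \<Rightarrow> nat \<Rightarrow> (nat \<Rightarrow> bit) \<Rightarrow> real" where
  "hit N m x = (\<Sum>i\<le>m. saw_num_to N i x * saw_num N (m - i))"

lemma card_hit:
  assumes "x \<in> cube N"
  shows "real (card {xs \<in> paths N m 0. x \<in> set xs}) \<le> hit N m x"
proof -
  have "{xs \<in> paths N m 0. x \<in> set xs} = (\<Union>i\<le>m. {xs \<in> paths N m 0. xs ! i = x})"
    by (auto simp: in_set_conv_nth paths_def less_Suc_eq_le)
  then have "card {xs \<in> paths N m 0. x \<in> set xs} \<le> (\<Sum>i\<le>m. card {xs \<in> paths N m 0. xs ! i = x})"
    by (simp add: card_UN_le)
  also have "\<dots> \<le> (\<Sum>i\<le>m. card (paths_to N i 0 x \<times> paths N (m - i) x))"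
  proof (rule sum_mono)
    fix i assume "i \<in> {..m}"
    show "card {xs \<in> paths N m 0. xs ! i = x} \<le> card (paths_to N i 0 x \<times> paths N (m - i) x)"
    proof (rule card_inj_on_le)
      show "inj_on (\<lambda>xs. (take (Suc i) xs, drop i xs)) {xs \<in> paths N m 0. xs ! i = x}"
        by (rule inj_onI) (auto intro: split_inj)
      show "(\<lambda>xs. (take (Suc i) xs, drop i xs)) ` {xs \<in> paths N m 0. xs ! i
        = x} \<subseteq> paths_to N i 0 x \<times> paths N (m - i) x"
        using split_path[of _ N m 0 i] \<open>i \<in> {..m}\<close> by auto
    qed (auto simp: finite_paths finite_paths_to)
  qed
  finally have "real (card {xs \<in> paths N m 0. x \<in> set xs})
    \<le> real (\<Sum>i\<le>m. card (paths_to N i 0 x \<times> paths N (m - i) x))"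
    by (simp only: of_nat_le_iff)
  also have "\<dots> = hit N m x"
    by (simp add: hit_def card_cartesian_product saw_num_to_def saw_num_eq card_paths_translate[OF assms])
  finally show ?thesis .
qed

text \<open>The first walk is run backwards into the origin and continued by the second;
  \<open>tl\<close> drops the second copy of the origin. The result starts at \<open>xs ! m\<close>,
  the endpoint of the first walk.\<close>

lemma join_paths:
  assumes "xs \<in> paths N m 0" "ys \<in> paths N n 0" "set xs \<inter> set ys = {0}"
  shows "rev xs @ tl ys \<in> paths N (m + n) (xs ! m)"
proof -
  obtain us where us: "xs = 0 # us" "length us = m" using assms(1) by (cases xs) (auto simp: paths_def)
  obtain vs where vs: "ys = 0 # vs" "length vs = n" using assms(2) by (cases ys) (auto simp: paths_def)
  have "spath N (rev xs)" using assms(1) by (simp add: spath_rev paths_def)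
  then have 1: "spath N (rev us @ [0])" by (simp add: us)
  have 2: "spath N (0 # vs)" using assms(2) vs by (simp add: paths_def)
  have "spath N (rev us @ [0] @ vs)"
    using 1 2 assms(3) unfolding us vs spath_def
    by (auto simp: successively_append_iff successively_Cons)
  moreover have "(rev us @ 0 # vs) ! 0 = (0 # us) ! m"
    using us(2) by (cases us rule: rev_cases) (auto simp: nth_append)
  ultimately show ?thesis using us vs by (simp add: paths_def)
qed

text \<open>Translated by its starting point \<open>xs ! m\<close>, the joined walk starts at 0, so
  such pairs inject into the walks of length \<open>m + n\<close>.\<close>

lemma card_disjoint_pairs:
  "real (card {(xs, ys). xs \<in> paths N m 0 \<and> ys \<in> paths N n 0 \<and> set xs \<inter> set ys = {0}}) \<le> saw_num N (m
    + n)"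
proof -
  let ?D = "{(xs, ys). xs \<in> paths N m 0 \<and> ys \<in> paths N n 0 \<and> set xs \<inter> set ys = {0}}"
  define g where "g = (\<lambda>(xs, ys). map ((+) (xs ! m)) (rev xs @ tl ys) :: (nat \<Rightarrow> bit) list)"
  have "card ?D \<le> card (paths N (m + n) 0)"
  proof (rule card_inj_on_le)
    show "g ` ?D \<subseteq> paths N (m + n) 0"
    proof clarify
      fix xs ys assume *: "xs \<in> paths N m 0" "ys \<in> paths N n 0" "set xs \<inter> set ys = {0}"
      have "xs ! m \<in> cube N" using *(1) by (auto simp: paths_def spath_def)
      from paths_translate[OF this join_paths[OF *]]
      show "g (xs, ys) \<in> paths N (m + n) 0" by (simp only: g_def prod.case add_self)
    qed
    show "inj_on g ?D"
    proof (rule inj_onI, clarify)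
      fix xs ys us vs
      assume *: "xs \<in> paths N m 0" "ys \<in> paths N n 0" "us \<in> paths N m 0" "vs \<in> paths N n 0"
        and eq: "g (xs, ys) = g (us, vs)"
      have l: "length xs = Suc m" "length us = Suc m" using * by (auto simp: paths_def)
      have z: "xs ! 0 = 0" "us ! 0 = 0" using * by (auto simp: paths_def)
      \<comment> \<open>The origin sits at position \<open>m\<close> of the joined list, so entry
        \<open>m\<close> of the image is the translation vector itself, and the translation can be
        undone.\<close>
      have "g (xs, ys) ! m = xs ! m" using l z by (simp add: g_def nth_append rev_nth)
      moreover have "g (us, vs) ! m = us ! m" using l z by (simp add: g_def nth_append rev_nth)
      ultimately have "xs ! m = us ! m" using eq by simp
      moreover have "inj ((+) (us ! m))" by simp
      ultimately have "rev xs @ tl ys = rev us @ tl vs"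
        using eq by (simp add: g_def inj_map_eq_map flip: map_append)
      then have "xs = us" "tl ys = tl vs" using l by auto
      moreover have "ys = 0 # tl ys" using *(2) by (cases ys) (auto simp: paths_def)
      moreover have "vs = 0 # tl vs" using *(4) by (cases vs) (auto simp: paths_def)
      ultimately show "xs = us \<and> ys = vs" by metis
    qed
  qed (simp add: finite_paths)
  then show ?thesis by (simp add: saw_num_eq)
qed

text \<open>
  Only pairs of walks that meet outside the origin fail to concatenate; each such pair is split
  at one of its common points.
\<close>

lemma saw_num_supermult:
  "saw_num N m * saw_num N n \<le> saw_num N (m + n) + (\<Sum>x\<in>cube N - {0}. hit N m x * hit N n x)"
proof -
  let ?D = "{(xs, ys). xs \<in> paths N m 0 \<and> ys \<in> paths N n 0 \<and> set xs \<inter> set ys = {0}}"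
  define T where "T = (\<lambda>m x. {xs \<in> paths N m 0. x \<in> set xs})"
  let ?U = "\<Union>x\<in>cube N - {0}. T m x \<times> T n x"
  have fT: "finite (T m x)" for m x by (simp add: T_def finite_paths)
  have fD: "finite ?D" by (rule finite_subset[of _ "paths N m 0 \<times> paths N n 0"]) (auto
    simp: finite_paths)
  have zero: "0 \<in> set xs" if "xs \<in> paths N k 0" for xs k
    using that by (cases xs) (auto simp: paths_def)
  have sub: "set xs \<subseteq> cube N" if "xs \<in> paths N k 0" for xs k
    using that by (auto simp: paths_def spath_def)
  have "paths N m 0 \<times> paths N n 0 \<subseteq> ?D \<union> ?U"
  proof clarify
    fix xs ys assume *: "xs \<in> paths N m 0" "ys \<in> paths N n 0"
      and "(xs, ys) \<notin> ?U"
    then show "set xs \<inter> set ys = {0}"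
      using zero[OF *(1)] zero[OF *(2)] sub[OF *(1)] by (auto simp: T_def)
  qed
  then have "card (paths N m 0 \<times> paths N n 0) \<le> card (?D \<union> ?U)"
    by (intro card_mono) (auto simp: fD fT finite_cube)
  also have "\<dots> \<le> card ?D + card ?U" by (rule card_Un_le)
  also have "card ?U \<le> (\<Sum>x\<in>cube N - {0}. card (T m x \<times> T n x))"
    by (rule card_UN_le) (simp add: finite_cube)
  finally have "real (card (paths N m 0 \<times> paths N n 0)) \<le> real (card ?D + (\<Sum>x\<in>cube N
    - {0}. card (T m x \<times> T n x)))"
    by (simp only: of_nat_le_iff add_le_cancel_left)
  also have "\<dots> = real (card ?D) + (\<Sum>x\<in>cube N - {0}. real (card (T m x)) * real (card (T n x)))"
    by (simp add: card_cartesian_product)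
  also have "\<dots> \<le> saw_num N (m + n) + (\<Sum>x\<in>cube N - {0}. hit N m x * hit N n x)"
    unfolding T_def
    by (intro add_mono card_disjoint_pairs sum_mono mult_mono card_hit)
       (auto simp: hit_def intro!: sum_nonneg mult_nonneg_nonneg saw_num_to_nonneg saw_num_nonneg)
  finally show ?thesis by (simp add: card_cartesian_product saw_num_eq)
qed

section \<open>Non-backtracking walks\<close>

definition unit_vec :: "nat \<Rightarrow> nat \<Rightarrow> bit" where
  "unit_vec i = (\<lambda>j. if j = i then 1 else 0)"

lemma unit_vec_cube: "i < N \<Longrightarrow> unit_vec i \<in> cube N"
  by (auto simp: unit_vec_def cube_def)

lemma unit_vec_eq_iff: "unit_vec i = unit_vec j \<longleftrightarrow> i = j"
  by (auto simp: unit_vec_def fun_eq_iff)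

lemma add_add_self: "(x + z) + z = (x :: nat \<Rightarrow> bit)"
  by (simp add: add.assoc add_self)

lemma adj_unit_vec: "i < N \<Longrightarrow> adj N (x + unit_vec i) x"
proof -
  assume "i < N"
  then have "{j. j < N \<and> unit_vec i j = 1} = {i}" by (auto simp: unit_vec_def)
  moreover have "x - (x + unit_vec i) = unit_vec i" by (simp add: minus_eq_plus add_self_left)
  ultimately show ?thesis by (simp add: adj_def weight_def)
qed

lemma weight_one_iff:
  assumes "x \<in> cube N"
  shows "weight N x = 1 \<longleftrightarrow> (\<exists>i<N. x = unit_vec i)"
proof
  assume "weight N x = 1"
  then obtain i where i: "{i. i < N \<and> x i = 1} = {i}"
    unfolding weight_def by (auto simp: card_1_singleton_iff)
  have "x = unit_vec i"
  proof
    fix j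
    have "j \<in> {i. i < N \<and> x i = 1} \<longleftrightarrow> j = i" unfolding i by simp
    then have "x j = 1 \<longleftrightarrow> j = i" using assms by (auto simp: cube_def not_less)
    then show "x j = unit_vec i j" by (auto simp: unit_vec_def)
  qed
  then show "\<exists>i<N. x = unit_vec i" using i by blast
next
  assume "\<exists>i<N. x = unit_vec i"
  then obtain i where "i < N" "x = unit_vec i" by blast
  then have "{j. j < N \<and> x j = 1} = {i}" by (auto simp: unit_vec_def)
  then show "weight N x = 1" by (simp add: weight_def)
qed

lemma adjE:
  assumes "adj N x y" "x \<in> cube N" "y \<in> cube N"
  obtains i where "i < N" "x = y + unit_vec i"
proof -
  have "weight N (y - x) = 1" using assms by (simp add: adj_def)
  then obtain i where "i < N" "y - x = unit_vec i"
    using weight_one_iff[OF cube_diff[OF assms(3,2)]] by blast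
  moreover have "x = y + (y - x)" by (simp add: minus_eq_plus add_self_left)
  ultimately show ?thesis using that by metis
qed

text \<open>The direction of the last step is recorded because it decides which next step would
  backtrack.\<close>

definition step_paths :: "nat \<Rightarrow> nat \<Rightarrow> (nat \<Rightarrow> bit) \<Rightarrow> nat \<Rightarrow> (nat \<Rightarrow> bit) list set" where
  "step_paths N n x i = {xs \<in> paths_to N (Suc n) 0 x. xs ! n = x + unit_vec i}"

definition step_cnt :: "nat \<Rightarrow> nat \<Rightarrow> (nat \<Rightarrow> bit) \<Rightarrow> nat \<Rightarrow> real" where
  "step_cnt N n x i = real (card (step_paths N n x i))"

lemma finite_step_paths: "finite (step_paths N n x i)"
  by (simp add: step_paths_def finite_paths_to)

lemma path_step:
  assumes "xs \<in> paths N n x" "Suc k \<le> n"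
  obtains i where "i < N" "xs ! k = xs ! Suc k + unit_vec i"
proof -
  have "adj N (xs ! k) (xs ! Suc k)"
    using assms successively_nth[of "adj N" xs k] by (auto simp: paths_def spath_def)
  moreover have "xs ! k \<in> cube N" "xs ! Suc k \<in> cube N"
    using assms nth_mem[of k xs] nth_mem[of "Suc k" xs] by (auto simp: paths_def spath_def)
  ultimately show ?thesis using adjE that by blast
qed

lemma saw_num_to_Suc_eq: "saw_num_to N (Suc n) x = (\<Sum>i<N. step_cnt N n x i)"
proof -
  have "paths_to N (Suc n) 0 x = (\<Union>i<N. step_paths N n x i)"
  proof (intro set_eqI iffI)
    fix xs assume xs: "xs \<in> paths_to N (Suc n) 0 x"
    then have "xs \<in> paths N (Suc n) 0" "xs ! Suc n = x" by (auto simp: paths_to_def)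
    then obtain i where "i < N" "xs ! n = x + unit_vec i"
      using path_step[of xs N "Suc n" 0 n] by auto
    then show "xs \<in> (\<Union>i<N. step_paths N n x i)" using xs by (auto simp: step_paths_def)
  qed (auto simp: step_paths_def)
  moreover have "card (\<Union>i<N. step_paths N n x i) = (\<Sum>i<N. card (step_paths N n x i))"
    by (rule card_UN_disjoint)
      (auto simp: finite_step_paths, auto simp: step_paths_def unit_vec_eq_iff)
  ultimately show ?thesis by (simp add: saw_num_to_def step_cnt_def)
qed

lemma butlast_path:
  assumes "xs \<in> paths N (Suc n) x"
  shows "butlast xs \<in> paths_to N n x (xs ! n)" "\<And>k. k \<le> n \<Longrightarrow> butlast xs ! k = xs ! k"
proof -
  have "butlast xs = take (Suc n) xs" using assms by (simp add: paths_def butlast_conv_take)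
  then show "butlast xs \<in> paths_to N n x (xs ! n)" using split_path(1)[OF assms, of n] by simp
  show "\<And>k. k \<le> n \<Longrightarrow> butlast xs ! k = xs ! k"
    using assms by (simp add: paths_def nth_butlast)
qed

lemma butlast_inj:
  assumes "xs \<in> paths_to N (Suc n) z x" "ys \<in> paths_to N (Suc n) z x" "butlast xs = butlast ys"
  shows "xs = ys"
proof -
  have ne: "xs \<noteq> []" "ys \<noteq> []" using assms by (auto simp: paths_to_def paths_def)
  then have "last xs = last ys" using assms by (auto simp: paths_to_def paths_def last_conv_nth)
  then show ?thesis using assms(3) ne append_butlast_last_id by metis
qed

lemma step_cnt_le_cnt: "step_cnt N n x i \<le> saw_num_to N n (x + unit_vec i)"
proof -
  have "card (step_paths N n x i) \<le> card (paths_to N n 0 (x + unit_vec i))"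
  proof (rule card_inj_on_le[OF _ _ finite_paths_to])
    show "inj_on butlast (step_paths N n x i)"
      by (rule inj_onI) (auto simp: step_paths_def intro: butlast_inj)
    show "butlast ` step_paths N n x i \<subseteq> paths_to N n 0 (x + unit_vec i)"
    proof (rule image_subsetI)
      fix xs assume "xs \<in> step_paths N n x i"
      then show "butlast xs \<in> paths_to N n 0 (x + unit_vec i)"
        using butlast_path(1)[of xs N n 0] by (auto simp: step_paths_def paths_to_def)
    qed
  qed
  then show ?thesis by (simp add: step_cnt_def saw_num_to_def)
qed

lemma saw_num_to_Suc_le: "saw_num_to N (Suc n) x \<le> (\<Sum>i<N. saw_num_to N n (x + unit_vec i))"
  unfolding saw_num_to_Suc_eq by (intro sum_mono step_cnt_le_cnt)

text \<open>Using direction \<open>i\<close> twice in a row would return to the vertex visited two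
  steps before. This is the only part of self-avoidance that is kept.\<close>

lemma step_cnt_Suc_le:
  "step_cnt N (Suc n) x i \<le> (\<Sum>j\<in>{..<N} - {i}. step_cnt N n (x + unit_vec i) j)"
proof -
  let ?U = "\<Union>j\<in>{..<N} - {i}. step_paths N n (x + unit_vec i) j"
  have "card (step_paths N (Suc n) x i) \<le> card ?U"
  proof (rule card_inj_on_le)
    show "inj_on butlast (step_paths N (Suc n) x i)"
      by (rule inj_onI) (auto simp: step_paths_def intro: butlast_inj)
    show "butlast ` step_paths N (Suc n) x i \<subseteq> ?U"
    proof (rule image_subsetI)
      fix xs assume "xs \<in> step_paths N (Suc n) x i"
      then have xs: "xs \<in> paths N (Suc (Suc n)) 0" "xs ! Suc (Suc n) = x" "xs ! Suc n = x + unit_vec i"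
        by (auto simp: step_paths_def paths_to_def)
      obtain j where j: "j < N" "xs ! n = x + unit_vec i + unit_vec j"
        using path_step[OF xs(1), of n] xs(3) by auto
      have "j \<noteq> i"
      proof
        assume "j = i"
        then have "xs ! n = xs ! Suc (Suc n)" using j xs by (simp add: add_add_self)
        then show False using xs(1) by (auto simp: paths_def spath_def nth_eq_iff_index_eq)
      qed
      moreover have "butlast xs \<in> step_paths N n (x + unit_vec i) j"
        using butlast_path[OF xs(1)] j xs(3) by (auto simp: step_paths_def)
      ultimately show "butlast xs \<in> ?U" using j(1) by auto
    qed
  qed (auto simp: finite_step_paths)
  also have "\<dots> \<le> (\<Sum>j\<in>{..<N} - {i}. card (step_paths N n (x + unit_vec i) j))"
    by (rule card_UN_le) auto
  finally have "real (card (step_paths N (Suc n) x i)) \<le> real \<dots>" by (simp only: of_nat_le_iff)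
  then show ?thesis by (simp add: step_cnt_def)
qed

lemma saw_num_to_0: "saw_num_to N 0 x = of_bool (x = 0)"
proof -
  have "paths_to N 0 0 x = (if x = 0 then {[0]} else {})"
    by (auto simp: paths_to_def paths_def spath_def length_Suc_conv zero_cube)
  then show ?thesis by (simp add: saw_num_to_def)
qed

lemma saw_num_to_zero: "n > 0 \<Longrightarrow> saw_num_to N n 0 = 0"
proof -
  assume "n > 0"
  have "xs \<notin> paths_to N n 0 0" for xs
  proof
    assume *: "xs \<in> paths_to N n 0 0"
    then have "xs ! n = xs ! 0" "distinct xs" "length xs = Suc n"
      by (auto simp: paths_to_def paths_def spath_def)
    then show False using \<open>n > 0\<close> nth_eq_iff_index_eq[of xs n 0] by simp
  qed
  then have "paths_to N n 0 0 = {}" by blast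
  then show ?thesis by (simp add: saw_num_to_def)
qed

lemma step_cnt_0:
  assumes "i < N" shows "step_cnt N 0 x i = of_bool (x = unit_vec i)"
proof -
  have "step_paths N 0 x i = (if x = unit_vec i then {[0, unit_vec i]} else {})"
  proof (intro set_eqI iffI)
    fix xs assume "xs \<in> step_paths N 0 x i"
    then have l: "length xs = Suc (Suc 0)" and *: "xs ! 0 = 0" "xs ! 1 = x" "0 = x + unit_vec i"
      by (auto simp: step_paths_def paths_to_def paths_def)
    have "x = unit_vec i" using arg_cong[OF *(3), of "\<lambda>y. y + unit_vec i"] by (simp add: add_add_self)
    then show "xs \<in> (if x = unit_vec i then {[0, unit_vec i]} else {})"
      using l * by (auto simp: length_Suc_conv)
  next
    fix xs assume "xs \<in> (if x = unit_vec i then {[0, unit_vec i]} else {})"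
    then have *: "x = unit_vec i" "xs = [0, unit_vec i]" by (auto split: if_splits)
    have "adj N 0 (unit_vec i)" using adj_unit_vec[OF assms, of "unit_vec i"] by (simp add: add_self)
    moreover have "(0 :: nat \<Rightarrow> bit) \<noteq> unit_vec i" by (auto simp: fun_eq_iff unit_vec_def)
    ultimately show "xs \<in> step_paths N 0 x i" using assms *
      by (auto simp: step_paths_def paths_to_def paths_def spath_def zero_cube unit_vec_cube add_self)
  qed
  then show ?thesis by (simp add: step_cnt_def)
qed

lemma sum_cube_translate:
  assumes "a \<in> cube N"
  shows "(\<Sum>x\<in>cube N. f (x + a)) = (\<Sum>x\<in>cube N. f x)"
  by (rule sum.reindex_bij_witness[where i = "\<lambda>x. x + a" and j = "\<lambda>x. x + a"])
     (auto simp: add_add_self cube_add assms)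

lemma saw_num_Suc_eq: "saw_num N (Suc n) = (\<Sum>i<N. \<Sum>x\<in>cube N. step_cnt N n x i)"
  unfolding saw_num_eq_sum saw_num_to_Suc_eq by (rule sum.swap)

lemma saw_num_1: "saw_num N (Suc 0) = real N"
proof -
  have "(\<Sum>i<N. \<Sum>x\<in>cube N. step_cnt N 0 x i) = (\<Sum>i<N. 1)"
  proof (rule sum.cong[OF refl])
    fix i assume "i \<in> {..<N}"
    then have "(\<Sum>x\<in>cube N. step_cnt N 0 x i) = (\<Sum>x\<in>cube N. if x = unit_vec i then 1 else 0)"
      by (intro sum.cong) (auto simp: step_cnt_0)
    then show "(\<Sum>x\<in>cube N. step_cnt N 0 x i) = 1"
      using \<open>i \<in> {..<N}\<close> by (simp add: finite_cube unit_vec_cube)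
  qed
  then show ?thesis by (simp add: saw_num_Suc_eq)
qed

text \<open>Once the endpoint is summed over, the translations disappear, and each direction
  \<open>j\<close> can be followed by the \<open>N - 1\<close> directions \<open>i\<close> other
  than \<open>j\<close>.\<close>

lemma saw_num_Suc_Suc_le:
  assumes "N \<ge> 1"
  shows "saw_num N (Suc (Suc n)) \<le> (real N - 1) * saw_num N (Suc n)"
proof -
  define T where "T = (\<lambda>j. \<Sum>x\<in>cube N. step_cnt N n x j)"
  have "saw_num N (Suc (Suc n)) \<le> (\<Sum>i<N. \<Sum>x\<in>cube N. \<Sum>j\<in>{..<N} - {i}. step_cnt N n (x + unit_vec i) j)"
    unfolding saw_num_Suc_eq[of N "Suc n"] by (intro sum_mono step_cnt_Suc_le)
  also have "\<dots> = (\<Sum>i<N. \<Sum>j\<in>{..<N} - {i}. \<Sum>x\<in>cube N. step_cnt N n (x + unit_vec i) j)"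
    by (intro sum.cong refl sum.swap)
  also have "\<dots> = (\<Sum>i<N. \<Sum>j\<in>{..<N} - {i}. T j)"
    unfolding T_def by (intro sum.cong refl sum_cube_translate) (auto simp: unit_vec_cube)
  also have "\<dots> = (\<Sum>i<N. (\<Sum>j<N. T j) - T i)"
    by (intro sum.cong refl) (simp add: sum_diff1)
  also have "\<dots> = (real N - 1) * (\<Sum>j<N. T j)"
    by (simp add: sum_subtractf algebra_simps)
  finally show ?thesis by (simp add: saw_num_Suc_eq T_def)
qed

text \<open>There are \<open>N\<close> first steps and a factor of at most \<open>N - 1\<close> for
  each later one; the constant 2 absorbs \<open>N <= 2 * (N - 1)\<close>.\<close>

lemma saw_num_le:
  assumes "N \<ge> 2"
  shows "saw_num N n \<le> 2 * (real N - 1) ^ n"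
proof (cases n)
  case 0
  then show ?thesis by (simp add: saw_num_def saw_count_0)
next
  case (Suc k)
  have "saw_num N (Suc k) \<le> real N * (real N - 1) ^ k"
  proof (induction k)
    case (Suc k)
    have "saw_num N (Suc (Suc k)) \<le> (real N - 1) * saw_num N (Suc k)"
      by (rule saw_num_Suc_Suc_le) (use assms in auto)
    also have "\<dots> \<le> (real N - 1) * (real N * (real N - 1) ^ k)"
      by (intro mult_left_mono Suc.IH) (use assms in auto)
    finally show ?case by (simp add: mult_ac)
  qed (simp add: saw_num_1)
  also have "\<dots> \<le> (2 * (real N - 1)) * (real N - 1) ^ k"
    by (intro mult_right_mono) (use assms in auto)
  finally show ?thesis unfolding Suc power_Suc by (simp only: mult.assoc)
qed

text \<open>\<open>nbw N n x i\<close> counts non-backtracking walks of length \<open>n + 1\<close> to \<open>x\<close> with last step in direction \<open>i\<close>.\<close>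

fun nbw :: "nat \<Rightarrow> nat \<Rightarrow> (nat \<Rightarrow> bit) \<Rightarrow> nat \<Rightarrow> real" where
  "nbw N 0 x i = of_bool (x = unit_vec i)"
| "nbw N (Suc n) x i = (\<Sum>j\<in>{..<N} - {i}. nbw N n (x + unit_vec i) j)"

lemma step_cnt_le_nbw: "i < N \<Longrightarrow> step_cnt N n x i \<le> nbw N n x i"
proof (induction n arbitrary: x i)
  case (Suc n)
  have "step_cnt N (Suc n) x i \<le> (\<Sum>j\<in>{..<N} - {i}. step_cnt N n (x + unit_vec i) j)"
    by (rule step_cnt_Suc_le)
  also have "\<dots> \<le> (\<Sum>j\<in>{..<N} - {i}. nbw N n (x + unit_vec i) j)"
    by (intro sum_mono Suc.IH) auto
  finally show ?case by simp
qed (simp add: step_cnt_0)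

section \<open>A closed recursion for the totals of non-backtracking walks\<close>

definition nbw_total :: "nat \<Rightarrow> nat \<Rightarrow> (nat \<Rightarrow> bit) \<Rightarrow> real" where
  "nbw_total N n x = (\<Sum>i<N. nbw N n x i)"

lemma saw_num_to_le_nbw_total: "saw_num_to N (Suc n) x \<le> nbw_total N n x"
  unfolding saw_num_to_Suc_eq nbw_total_def by (intro sum_mono step_cnt_le_nbw) auto

text \<open>At the second step each of the \<open>N\<close> first steps has one reversal, and all of
  them lead back to the origin; hence the factor \<open>N\<close> here, as against
  \<open>N - 1\<close> later.\<close>

lemma nbw_total_1:
  "nbw_total N (Suc 0) x = (\<Sum>i<N. nbw_total N 0 (x + unit_vec i)) - real N * of_bool (x = 0)"
proof -
  have "nbw N (Suc 0) x i = nbw_total N 0 (x + unit_vec i) - of_bool (x = 0)" if "i < N" for i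
  proof -
    have "nbw N 0 (x + unit_vec i) i = of_bool (x = 0)" by simp
    then show ?thesis using that
      by (simp add: nbw_total_def sum_diff1 del: nbw.simps(1))
  qed
  then have "nbw_total N (Suc 0) x = (\<Sum>i<N. nbw_total N 0 (x + unit_vec i) - of_bool (x = 0))"
    unfolding nbw_total_def[of N "Suc 0"] by (intro sum.cong) auto
  then show ?thesis by (simp add: sum_subtractf)
qed

text \<open>The exclusion of reversals is expanded twice: the walks to be subtracted for direction
  \<open>i\<close> are those that were at \<open>x\<close> two steps before and had not arrived
  there in direction \<open>i\<close>. Summed over \<open>i\<close>, this is \<open>N - 1\<close>
  times the shorter total, and the directions drop out.\<close>

lemma nbw_total_Suc_Suc:
  "nbw_total N (Suc (Suc n)) x =
    (\<Sum>i<N. nbw_total N (Suc n) (x + unit_vec i)) - (real N - 1) * nbw_total N n x"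
proof -
  have "nbw N (Suc (Suc n)) x i = nbw_total N (Suc n) (x + unit_vec i) - (nbw_total N n x - nbw N n x i)"
    if "i < N" for i
  proof -
    have "nbw N (Suc n) (x + unit_vec i) i = nbw_total N n x - nbw N n x i"
      using that by (simp add: nbw_total_def sum_diff1 add_add_self)
    then show ?thesis using that
      by (simp add: nbw_total_def sum_diff1 del: nbw.simps(2) add: nbw.simps(2)[of N "Suc n"])
  qed
  then have "nbw_total N (Suc (Suc n)) x = (\<Sum>i<N. nbw_total N (Suc n) (x + unit_vec i)
    - (nbw_total N n x - nbw N n x i))"
    unfolding nbw_total_def[of N "Suc (Suc n)"] by (intro sum.cong) auto
  also have "\<dots> = (\<Sum>i<N. nbw_total N (Suc n) (x + unit_vec i)) - (real N * nbw_total N n x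
    - nbw_total N n x)"
    by (simp add: sum_subtractf nbw_total_def)
  finally show ?thesis by (simp add: algebra_simps)
qed

section \<open>Mixing of the non-backtracking walk\<close>

text \<open>The group characters of the cube, indexed by sets of coordinates: -1 to the power of the
  sum of the \<open>x i\<close> over \<open>S\<close>.\<close>

definition character :: "nat set \<Rightarrow> (nat \<Rightarrow> bit) \<Rightarrow> real" where
  "character S x = (\<Prod>i\<in>S. if x i = 1 then -1 else 1)"

lemma abs_character: "\<bar>character S x\<bar> = 1"
  unfolding character_def abs_prod by (intro prod.neutral) auto

lemma character_unit_vec:
  assumes "finite S"
  shows "character S (x + unit_vec i) = (if i \<in> S then -1 else 1) * character S x"
proof (cases "i \<in> S")
  case True
  have *: "character S y = (if y i = 1 then -1 else 1) * (\<Prod>i\<in>S - {i}. if y i = 1 then -1 else 1)" for y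
    unfolding character_def by (rule prod.remove[OF assms True])
  have "(\<Prod>k\<in>S - {i}. if (x + unit_vec i) k = 1 then -1 else 1 :: real) = (\<Prod>i\<in>S - {i}. if x i
    = 1 then -1 else 1)"
    by (intro prod.cong) (auto simp: unit_vec_def)
  then show ?thesis using True unfolding *[of "x + unit_vec i"] *[of x]
    by (cases "x i") (auto simp: unit_vec_def)
next
  case False
  then show ?thesis unfolding character_def by (auto intro!: prod.cong simp: unit_vec_def)
qed

text \<open>Characters are eigenfunctions of the adjacency operator: a step in a direction of
  \<open>S\<close> contributes -1, any other step contributes 1.\<close>

lemma character_laplacian:
  assumes "S \<subseteq> {..<N}"
  shows "(\<Sum>i<N. character S (x + unit_vec i)) = (real N - 2 * real (card S)) * character S x"
proof -
  have f: "finite S" using assms finite_subset by blast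
  have "(\<Sum>i<N. if i \<in> S then -1 else 1 :: real) = (\<Sum>i<N. 1 - 2 * indicator S i)"
    by (intro sum.cong) auto
  also have "\<dots> = real N - 2 * real (card S)"
    using assms by (simp add: sum_subtractf flip: sum_distrib_left)
      (simp add: indicator_def Int_absorb1)
  finally show ?thesis by (simp add: character_unit_vec[OF f] flip: sum_distrib_right)
qed

text \<open>The sum over subsets is an expanded product over the coordinates, in which every
  coordinate of \<open>x\<close> equal to 1 gives a factor 0.\<close>

lemma character_inversion:
  assumes "x \<in> cube N"
  shows "(\<Sum>S\<in>Pow {..<N}. character S x) = 2 ^ N * of_bool (x = 0)"
proof -
  have "(\<Prod>i<N. (if x i = 1 then -1 else 1) + (1::real)) = (\<Sum>S\<in>Pow {..<N}. character S x)"
    by (subst prod_add) (auto simp: character_def)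
  moreover have "(\<Prod>i<N. (if x i = 1 then -1 else 1) + (1::real)) = 2 ^ N * of_bool (x = 0)"
  proof (cases "x = 0")
    case False
    then obtain i where "x i \<noteq> 0" by (auto simp: fun_eq_iff)
    then have "i < N" "x i = 1" using assms by (auto simp: cube_def not_less[symmetric])
    then have "(\<Prod>i<N. (if x i = 1 then -1 else 1) + (1::real)) = 0"
      by (intro prod_zero) auto
    then show ?thesis using False by simp
  qed simp
  ultimately show ?thesis by simp
qed

text \<open>
  The recursion for non-backtracking walks, diagonalised and divided by \<open>(N - 1)\<^sup>n\<close>. The initial value
  \<open>N / (N - 1)\<close> in place of 1 makes the recursion hold from \<open>n = 0\<close> on: there are \<open>N\<close> first steps
  but only \<open>N - 1\<close> later ones.
\<close>

fun eig :: "nat \<Rightarrow> nat \<Rightarrow> nat \<Rightarrow> real" where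
  "eig N j 0 = real N / (real N - 1)"
| "eig N j (Suc 0) = (real N - 2 * real j) / (real N - 1)"
| "eig N j (Suc (Suc n)) =
    (real N - 2 * real j) / (real N - 1) * eig N j (Suc n) - eig N j n / (real N - 1)"

lemma nbw_total_0: "nbw_total N 0 x = (\<Sum>i<N. of_bool (x + unit_vec i = 0))"
proof -
  have "x + unit_vec i = 0 \<longleftrightarrow> x = unit_vec i" for i
  proof
    assume "x + unit_vec i = 0"
    then show "x = unit_vec i" using add_add_self[of x "unit_vec i"] by simp
  qed (simp only: add_self)
  then show ?thesis by (simp add: nbw_total_def)
qed

text \<open>An unnormalised inverse Fourier transform. For \<open>n >= 1\<close> it is
  \<open>2 ^ N\<close> times the number of non-backtracking walks with \<open>n\<close> steps, that
  is \<open>nbw_total\<close> at index \<open>n - 1\<close>; the value at \<open>n = 0\<close> only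
  starts the recursion.\<close>

definition spectral :: "nat \<Rightarrow> nat \<Rightarrow> (nat \<Rightarrow> bit) \<Rightarrow> real" where
  "spectral N n x = (real N - 1) ^ n * (\<Sum>S\<in>Pow {..<N}. eig N (card S) n * character S x)"

lemma spectral_0:
  assumes "x \<in> cube N"
  shows "spectral N 0 x = real N / (real N - 1) * 2 ^ N * of_bool (x = 0)"
  by (simp add: spectral_def sum_distrib_left[symmetric] character_inversion[OF assms] del: times_divide_eq_left)

lemma spectral_1:
  assumes "N \<ge> 2" "x \<in> cube N"
  shows "spectral N (Suc 0) x = 2 ^ N * nbw_total N 0 x"
proof -
  have "(\<Sum>S\<in>Pow {..<N}. eig N (card S) (Suc 0) * character S x) =
     (\<Sum>S\<in>Pow {..<N}. \<Sum>i<N. character S (x + unit_vec i)) / (real N - 1)"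
    unfolding sum_divide_distrib[of _ "Pow {..<N}"] by (intro sum.cong) (auto simp: character_laplacian)
  also have "(\<Sum>S\<in>Pow {..<N}. \<Sum>i<N. character S (x + unit_vec i)) = 2 ^ N * nbw_total N 0 x"
    using assms(2) by (subst sum.swap)
      (simp add: character_inversion cube_add unit_vec_cube nbw_total_0 sum_distrib_left)
  finally show ?thesis using assms(1) by (simp add: spectral_def)
qed

lemma spectral_Suc_Suc:
  assumes "N \<ge> 2"
  shows "spectral N (Suc (Suc n)) x =
    (\<Sum>i<N. spectral N (Suc n) (x + unit_vec i)) - (real N - 1) * spectral N n x"
proof -
  have p: "real N - 1 \<noteq> 0" using assms by auto
  have "(\<Sum>i<N. spectral N (Suc n) (x + unit_vec i)) = (real N - 1) ^ Suc n *
     (\<Sum>S\<in>Pow {..<N}. eig N (card S) (Suc n) * (\<Sum>i<N. character S (x + unit_vec i)))"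
    unfolding spectral_def sum_distrib_left[symmetric]
    by (subst sum.swap) (simp only: sum_distrib_left[symmetric])
  also have "\<dots> = (real N - 1) ^ Suc n *
     (\<Sum>S\<in>Pow {..<N}. eig N (card S) (Suc n) * ((real N - 2 * real (card S)) * character S x))"
    by (intro arg_cong2[where f = "(*)"] sum.cong refl arg_cong2[where f
      = "(*)"] character_laplacian) auto
  finally have *: "(\<Sum>i<N. spectral N (Suc n) (x + unit_vec i)) = \<dots>" .
  have scale: "(real N - 1) ^ Suc (Suc n) * eig N j (Suc (Suc n)) =
     (real N - 1) ^ Suc n * (eig N j (Suc n) * (real N - 2 * real j)) - (real N
       - 1) ^ Suc n * eig N j n" for j
  proof -
    have "q ^ Suc (Suc n) * (t / q * a - b / q) = q ^ Suc n * (a * t) - q ^ Suc n * b"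
      if "q \<noteq> 0" for q t a b :: real using that by (simp add: field_simps)
    from this[OF p] show ?thesis by simp
  qed
  have "spectral N (Suc (Suc n)) x = (\<Sum>S\<in>Pow {..<N}.
     (real N - 1) ^ Suc n * (eig N (card S) (Suc n) * ((real N - 2 * real (card S)) * character S x))
     - (real N - 1) * ((real N - 1) ^ n * (eig N (card S) n * character S x)))"
    unfolding spectral_def sum_distrib_left mult.assoc[symmetric, of _ "eig N _ (Suc (Suc n))"] scale
    by (intro sum.cong refl) (simp add: left_diff_distrib mult.assoc)
  then show ?thesis unfolding * by (simp add: spectral_def sum_subtractf sum_distrib_left)
qed

lemma nbw_total_spectral:
  assumes "N \<ge> 2" "x \<in> cube N"
  shows "2 ^ N * nbw_total N n x = spectral N (Suc n) x"
  using assms(2)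
proof (induction n arbitrary: x rule: induct_nat_012)
  case 0
  then show ?case by (simp add: spectral_1 assms(1))
next
  case 1
  have "(\<Sum>i<N. spectral N (Suc 0) (x + unit_vec i)) = 2 ^ N * (\<Sum>i<N. nbw_total N 0 (x + unit_vec i))"
    using 1 unfolding sum_distrib_left
      by (intro sum.cong spectral_1 assms(1)) (auto intro: cube_add unit_vec_cube)
  \<comment> \<open>The value \<open>N / (N - 1)\<close> in \<open>spectral_0\<close> times the
    factor \<open>N - 1\<close> of the recursion is exactly the exceptional term
    \<open>N * of_bool (x = 0)\<close> of \<open>nbw_total_1\<close>.\<close>
  then show ?case using assms(1)
    unfolding spectral_Suc_Suc[OF assms(1), of 0] nbw_total_1 spectral_0[OF 1]
    by (simp del: of_bool_eq add: right_diff_distrib)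
next
  case (ge2 n)
  have c: "x + unit_vec i \<in> cube N" if "i < N" for i
    using that ge2(3) by (intro cube_add unit_vec_cube)
  have "(\<Sum>i<N. spectral N (Suc (Suc n)) (x + unit_vec i)) = 2 ^ N * (\<Sum>i<N. nbw_total N (Suc n) (x
    + unit_vec i))"
    unfolding sum_distrib_left by (intro sum.cong refl ge2(2)[symmetric] c) simp
  then show ?case using assms(1)
    unfolding spectral_Suc_Suc[OF assms(1), of "Suc n"] nbw_total_Suc_Suc ge2(1)[OF ge2(3), symmetric]
    by (simp add: algebra_simps)
qed

text \<open>
  For \<open>j = 1\<close> the triangle inequality of \<open>abs_recursion\<close> gives no decay;
  here the sign of the second term has to be exploited.
\<close>

lemma ratio_recursion:
  fixes v :: "nat \<Rightarrow> real"
  assumes p: "p \<ge> 6" and s: "s = 1 - 1 / p"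
    and v0: "v 0 = 1 + 1 / p" "v 1 = s" "\<And>n. v (Suc (Suc n)) = s * v (Suc n) - v n / p"
  shows "0 < v n \<and> v n / 2 \<le> v (Suc n) \<and> v (Suc n) \<le> s * v n"
proof (induction n)
  case 0
  have "0 < v 0" using p v0 by (simp add: add_pos_pos)
  moreover have "1 / p \<le> 1 / 6" "0 < 1 / p" using p by (auto simp: field_simps)
  moreover have "s * 1 \<le> s * v 0" using v0 s p by (intro mult_left_mono) auto
  moreover have "v (Suc 0) = 1 - 1 / p" using v0(2) s by simp
  ultimately show ?case using s v0(1) by linarith
next
  case (Suc n)
  have p6: "1 / p \<le> 1 / 6" "0 < 1 / p" using p by (auto simp: field_simps)
  have pos: "v (Suc n) > 0" using Suc by linarith
  \<comment> \<open>The lower ratio bound gives \<open>v n <= 2 * v (Suc n)\<close>, so at least the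
    fraction \<open>1 - 3 / p >= 1 / 2\<close> of \<open>v (Suc n)\<close> survives. The upper ratio
    bound only needs the subtracted term to be nonnegative.\<close>
  have "v n / p \<le> 2 * v (Suc n) * (1 / p)" using Suc p6 by (simp add: field_simps)
  also have "2 * v (Suc n) * (1 / p) = 2 * (1 / p) * v (Suc n)" by simp
  finally have "v (Suc (Suc n)) \<ge> (1 - 3 * (1 / p)) * v (Suc n)"
    unfolding v0(3) s by (simp add: algebra_simps)
  moreover have "(1 / 2) * v (Suc n) \<le> (1 - 3 * (1 / p)) * v (Suc n)"
    using p6 pos by (intro mult_right_mono) auto
  moreover have "v n / p \<ge> 0" using Suc p by simp
  ultimately show ?case using pos v0(3)[of n] by linarith
qed

text \<open>The condition on \<open>r\<close> says that \<open>c * r ^ n\<close> is a supersolution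
  of the recursion.\<close>

lemma abs_recursion:
  fixes v :: "nat \<Rightarrow> real"
  assumes "c \<ge> 0" "r \<ge> 0" "s * r + q \<le> r\<^sup>2" "s \<ge> 0" "q \<ge> 0"
    and v0: "\<bar>v 0\<bar> \<le> c" "\<bar>v 1\<bar> \<le> c * r" "\<And>n. \<bar>v (Suc (Suc n))\<bar> \<le> s * \<bar>v (Suc n)\<bar> + q * \<bar>v n\<bar>"
  shows "\<bar>v n\<bar> \<le> c * r ^ n"
proof (induction n rule: induct_nat_012)
  case (ge2 n)
  have "\<bar>v (Suc (Suc n))\<bar> \<le> s * \<bar>v (Suc n)\<bar> + q * \<bar>v n\<bar>" by (rule v0(3))
  also have "\<dots> \<le> s * (c * r ^ Suc n) + q * (c * r ^ n)"
    using ge2 assms by (intro add_mono mult_left_mono) auto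
  also have "\<dots> = c * r ^ n * (s * r + q)" by (simp add: algebra_simps)
  also have "\<dots> \<le> c * r ^ n * r\<^sup>2" using assms by (intro mult_left_mono) auto
  finally show ?case by (simp add: power2_eq_square algebra_simps)
qed (use v0 in auto)

text \<open>Passing from \<open>j\<close> to \<open>N - j\<close> flips the sign of
  \<open>N - 2 * j\<close> and multiplies \<open>eig\<close> by \<open>(-1) ^ n\<close>, as the cube
  is bipartite; \<open>\<sigma>\<close> removes this sign, so only \<open>h\<close>, the smaller of
  \<open>j\<close> and \<open>N - j\<close>, matters. There is no decay for \<open>h = 0\<close>;
  \<open>h = 1\<close> needs \<open>ratio_recursion\<close>, and \<open>h >= 2\<close> follows from
  \<open>abs_recursion\<close>.\<close>

lemma eig_bound:
  assumes N: "N \<ge> 7" and h: "2 * h \<le> N" "j = h \<or> j = N - h"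
  shows "\<bar>eig N j n\<bar> \<le> 2 * (1 - real h / (4 * (real N - 1))) ^ n"
proof -
  define p where "p = real N - 1"
  define s where "s = (real N - 2 * real h) / p"
  define \<sigma> :: real where "\<sigma> = (if j = h then 1 else - 1)"
  define v where "v = (\<lambda>n. \<sigma> ^ n * eig N j n)"
  define r where "r = 1 - real h / (4 * p)"
  have p: "p \<ge> 6" using N by (simp add: p_def)
  have \<sigma>: "\<sigma> * \<sigma> = 1" "\<bar>\<sigma>\<bar> = 1" by (auto simp: \<sigma>_def)
  have abs_v: "\<bar>eig N j n\<bar> = \<bar>v n\<bar>" for n by (simp add: v_def abs_mult power_abs \<sigma>)
  have s\<sigma>: "(real N - 2 * real j) / p = \<sigma> * s" using h
    by (auto simp: s_def \<sigma>_def of_nat_diff field_simps)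
  have v0: "v 0 = 1 + 1 / p" using p by (simp add: v_def p_def[symmetric]) (simp add: p_def field_simps)
  have v1: "v 1 = s" using \<sigma> s\<sigma> by (simp add: v_def p_def[symmetric] mult.assoc[symmetric])
  have v2: "v (Suc (Suc n)) = s * v (Suc n) - v n / p" for n
  proof -
    have "v (Suc (Suc n)) = \<sigma> ^ n * (\<sigma> * \<sigma> * (\<sigma> * s * eig N j (Suc n) - eig N j n / p))"
      by (simp add: v_def p_def[symmetric] s\<sigma>)
    also have "\<dots> = \<sigma> ^ n * ((\<sigma> * s * eig N j (Suc n) - eig N j n / p))" unfolding \<sigma> by simp
    finally show ?thesis by (simp add: v_def algebra_simps)
  qed
  have s0: "s \<ge> 0" using p h by (simp add: s_def)
  consider "h = 0" | "h = 1" | "h \<ge> 2" by linarith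
  then have "\<bar>v n\<bar> \<le> 2 * r ^ n"
  proof cases
    case 1
    then have s: "s = 1 + 1 / p" using p by (simp add: s_def field_simps p_def)
    \<comment> \<open>Here 1 is a root of the characteristic equation, and the initial values make
      the sequence constant.\<close>
    have "v n = 1 + 1 / p"
    proof (induction n rule: induct_nat_012)
      case (ge2 n)
      then show ?case unfolding v2 s using p by (simp add: field_simps)
    qed (use v0 v1 s in auto)
    moreover have "1 / p \<ge> 0" "1 / p \<le> 1" using p by auto
    ultimately show ?thesis using 1 by (simp add: r_def)
  next
    case 2
    then have s: "s = 1 - 1 / p" using p by (simp add: s_def field_simps p_def)
    note R = ratio_recursion[where v = v, OF p s v0 v1 v2]
    have "v n \<le> 2 * s ^ n"
    proof (induction n)
      case (Suc n)
      have "v (Suc n) \<le> s * v n" using R by blast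
      also have "\<dots> \<le> s * (2 * s ^ n)" using Suc s0 by (intro mult_left_mono) auto
      finally show ?case by simp
    qed (use v0 p in simp)
    moreover have "v n > 0" using R by blast
    moreover have "s ^ n \<le> r ^ n" using 2 p s s0 by (intro power_mono) (auto simp: r_def field_simps)
    ultimately show ?thesis by linarith
  next
    case 3
    have hp: "real h / p \<ge> 2 / p" using 3 p by (intro divide_right_mono) auto
    have s: "s = 1 - 2 * (real h / p) + 1 / p" using p by (simp add: s_def field_simps p_def)
    have "2 * real h \<le> real N" using h(1) by (simp flip: of_nat_mult)
    then have "2 * real h \<le> p + 1" by (simp add: p_def)
    then have r: "r \<ge> 3 / 4" using p by (simp add: r_def field_simps)
    have rs: "r - s = 7 / 4 * (real h / p) - 1 / p" by (simp add: r_def s)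
    \<comment> \<open>By \<open>h >= 2\<close> the gap \<open>r - s\<close> is at least
      \<open>5 / 2 * (1 / p)\<close>, and \<open>15 / 8 > 1\<close>. For \<open>h = 1\<close> the
      gap would be only \<open>3 / 4 * (1 / p)\<close>, too small for the supersolution.\<close>
    have "(3 / 4) * (5 / 2 * (1 / p)) \<le> r * (r - s)" using hp r p rs by (intro mult_mono) auto
    moreover have "1 / p > 0" using p by simp
    ultimately have "1 / p \<le> r * (r - s)" by linarith
    then have "s * r + 1 / p \<le> r\<^sup>2" by (simp add: power2_eq_square algebra_simps)
    then show ?thesis
    proof (rule abs_recursion[rotated 2])
      have "1 / p > 0" using p by simp
      then have "s \<le> r" using rs hp by linarith
      then show "\<bar>v 1\<bar> \<le> 2 * r" using v1 s0 r by auto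
      show "\<bar>v (Suc (Suc n))\<bar> \<le> s * \<bar>v (Suc n)\<bar> + 1 / p * \<bar>v n\<bar>" for n
        unfolding v2 using abs_triangle_ineq4[of "s * v (Suc n)" "v n / p"] s0 p by (simp add: abs_mult)
      have "0 \<le> 1 / p" "1 / p \<le> 1" using p by auto
      then show "\<bar>v 0\<bar> \<le> 2" unfolding v0 by linarith
    qed (use r s0 p in auto)
  qed
  then show ?thesis by (simp add: abs_v r_def p_def)
qed

text \<open>A sum of two powers replaces the power with exponent \<open>min j (N - j)\<close>,
  because each of them can be summed over all subsets in closed form.\<close>

lemma eig_bound_exp:
  assumes N: "N \<ge> 7" and j: "j \<le> N" and \<rho>: "\<rho> = exp (- real n / (4 * (real N - 1)))"
  shows "\<bar>eig N j n\<bar> \<le> 2 * \<rho> ^ j + 2 * \<rho> ^ (N - j)"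
proof -
  have *: "\<bar>eig N j n\<bar> \<le> 2 * \<rho> ^ h" if h: "2 * h \<le> N" "j = h \<or> j = N - h" for h
  proof -
    have "\<bar>eig N j n\<bar> \<le> 2 * (1 - real h / (4 * (real N - 1))) ^ n" by (rule eig_bound[OF N h])
    also have "(1 - real h / (4 * (real N - 1))) ^ n \<le> exp (- real h / (4 * (real N - 1))) ^ n"
    proof (rule power_mono)
      show "1 - real h / (4 * (real N - 1)) \<le> exp (- real h / (4 * (real N - 1)))"
        using exp_ge_add_one_self[of "- real h / (4 * (real N - 1))"] by simp
      have "2 * real h \<le> real N" using h(1) by (simp flip: of_nat_mult)
      then show "0 \<le> 1 - real h / (4 * (real N - 1))" using N by (simp add: field_simps)
    qed
    also have "exp (- real h / (4 * (real N - 1))) ^ n = \<rho> ^ h"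
      by (simp add: \<rho> exp_of_nat_mult[symmetric] mult_ac)
    finally show ?thesis by simp
  qed
  have "\<rho> > 0" using \<rho> by simp
  then have "\<rho> ^ j \<ge> 0" "\<rho> ^ (N - j) \<ge> 0" by auto
  moreover have "2 * j \<le> N \<or> 2 * (N - j) \<le> N" by linarith
  moreover have "j = N - (N - j)" using j by simp
  ultimately show ?thesis using *[of j] *[of "N - j"] by fastforce
qed

lemma sum_power_card: "(\<Sum>S\<in>Pow {..<N}. a ^ card S) = (1 + a :: real) ^ N"
proof -
  have "(\<Prod>i<N. a + 1) = (\<Sum>S\<in>Pow {..<N}. a ^ card S)"
    by (subst prod_add) auto
  then show ?thesis by (simp add: add.commute)
qed

text \<open>Self-avoiding walks are non-backtracking, and absolute values are taken in the Fourier
  expansion of the latter. With \<open>\<rho>\<close> the exponential in \<open>mix\<close>, the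
  coefficients sum to at most \<open>4 * (1 + \<rho>) ^ N <= 4 * exp (N * \<rho>) <= 4 * exp 1 <=
  12\<close>.\<close>

lemma saw_num_to_uniform_bound:
  assumes N: "N \<ge> 7" and m: "m \<ge> 1" and mix: "real N * exp (- real m / (4 * (real N - 1))) \<le> 1"
  shows "saw_num_to N m x \<le> 12 * (real N - 1) ^ m / real (vol N)"
proof (cases "x \<in> cube N")
  case True
  define \<rho> where "\<rho> = exp (- real m / (4 * (real N - 1)))"
  obtain n where n: "m = Suc n" using m by (cases m) auto
  have fin: "finite (Pow {..<N})" by simp
  have c1: "(\<Sum>S\<in>Pow {..<N}. \<rho> ^ (N - card S)) = (\<Sum>S\<in>Pow {..<N}. \<rho> ^ card S)"
    by (rule sum.reindex_bij_witness[where i = "\<lambda>S. {..<N} - S" and j = "\<lambda>S. {..<N} - S"])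
       (auto simp: card_Diff_subset finite_subset double_diff)
  have "(1 + \<rho>) ^ N \<le> exp \<rho> ^ N" using exp_ge_add_one_self[of \<rho>] by (intro power_mono) (auto simp: \<rho>_def)
  also have "\<dots> = exp (real N * \<rho>)" by (simp add: exp_of_nat_mult)
  also have "\<dots> \<le> exp 1" using mix by (simp add: \<rho>_def)
  also have "\<dots> \<le> 3" by (rule exp_le)
  finally have e: "(1 + \<rho>) ^ N \<le> 3" .
  have cS: "card S \<le> N" if "S \<in> Pow {..<N}" for S
    using that card_mono[of "{..<N}" S] by auto
  have "(\<Sum>S\<in>Pow {..<N}. eig N (card S) m * character S x) \<le> (\<Sum>S\<in>Pow {..<N}. \<bar>eig N (card S) m\<bar>)"
  proof (rule sum_mono)
    fix S
    have "eig N (card S) m * character S x \<le> \<bar>eig N (card S) m * character S x\<bar>" by simp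
    then show "eig N (card S) m * character S x \<le> \<bar>eig N (card S) m\<bar>"
      by (simp add: abs_mult abs_character)
  qed
  also have "\<dots> \<le> (\<Sum>S\<in>Pow {..<N}. 2 * \<rho> ^ card S + 2 * \<rho> ^ (N - card S))"
    by (intro sum_mono eig_bound_exp N cS \<rho>_def)
  also have "\<dots> = 4 * (1 + \<rho>) ^ N"
    by (simp add: sum.distrib c1 sum_power_card flip: sum_distrib_left)
  also have "\<dots> \<le> 12" using e by simp
  finally have "spectral N m x \<le> (real N - 1) ^ m * 12"
    unfolding spectral_def using N by (intro mult_left_mono) auto
  moreover have "2 ^ N * saw_num_to N m x \<le> 2 ^ N * nbw_total N n x"
    unfolding n by (intro mult_left_mono saw_num_to_le_nbw_total) auto
  ultimately have "2 ^ N * saw_num_to N m x \<le> 12 * (real N - 1) ^ m"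
    using nbw_total_spectral[of N x n] True N n by simp
  then show ?thesis by (simp add: vol_def field_simps)
qed (use N in \<open>auto simp: saw_num_to_outside\<close>)

section \<open>Short-distance bounds\<close>

lemma weight_add_unit_vec:
  assumes "i < N"
  shows "x i = 1 \<Longrightarrow> weight N x = Suc (weight N (x + unit_vec i))"
    "x i \<noteq> 1 \<Longrightarrow> weight N (x + unit_vec i) = Suc (weight N x)"
proof -
  have *: "weight N y = Suc (weight N (y + unit_vec i))" if "y i = 1" for y
  proof -
    have "{j. j < N \<and> y j = 1} = insert i {j. j < N \<and> (y + unit_vec i) j = 1}"
      using that assms by (auto simp: unit_vec_def)
    moreover have "i \<notin> {j. j < N \<and> (y + unit_vec i) j = 1}" using that by (simp add: unit_vec_def)
    ultimately show ?thesis by (simp add: weight_def)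
  qed
  show "x i = 1 \<Longrightarrow> weight N x = Suc (weight N (x + unit_vec i))" by (rule *)
  assume "x i \<noteq> 1"
  then have "(x + unit_vec i) i = 1" by (simp add: unit_vec_def)
  from *[of "x + unit_vec i", OF this] show "weight N (x + unit_vec i) = Suc (weight N x)"
    by (simp only: add_add_self)
qed

lemma weight_0_iff: "x \<in> cube N \<Longrightarrow> weight N x = 0 \<longleftrightarrow> x = 0"
proof
  assume x: "x \<in> cube N" and w: "weight N x = 0"
  show "x = 0"
  proof
    fix i show "x i = 0 i"
      using x w by (cases "i < N") (auto simp: weight_def cube_def not_less)
  qed
qed (simp add: weight_def)

text \<open>Every step changes the weight by exactly one.\<close>

lemma saw_num_to_parity: "saw_num_to N k x \<noteq> 0 \<Longrightarrow> weight N x \<le> k \<and> even (k + weight N x)"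
proof (induction k arbitrary: x)
  case 0
  then show ?case by (auto simp: saw_num_to_0 weight_def)
next
  case (Suc k)
  have "\<exists>i<N. saw_num_to N k (x + unit_vec i) \<noteq> 0"
  proof (rule ccontr)
    assume "\<not> ?thesis"
    then have "(\<Sum>i<N. saw_num_to N k (x + unit_vec i)) = 0" by simp
    then show False using saw_num_to_Suc_le[of N k x] saw_num_to_nonneg[of N "Suc k" x] Suc.prems by linarith
  qed
  then obtain i where i: "i < N" "saw_num_to N k (x + unit_vec i) \<noteq> 0" by blast
  define w where "w = weight N (x + unit_vec i)"
  have "w \<le> k" "even (k + w)" using Suc.IH[OF i(2)] by (simp_all only: w_def)
  moreover have "weight N x = Suc w \<or> w = Suc (weight N x)"
    using weight_add_unit_vec[OF i(1), of x] unfolding w_def by blast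
  ultimately show ?case by auto
qed

text \<open>Directions outside the support of \<open>x\<close> must cancel in pairs, so only about
  half of the \<open>k - weight N x\<close> surplus steps are free. Powers of \<open>sqrt N\<close>
  on both sides avoid a halved exponent. Induction on the last step.\<close>

lemma saw_num_to_short:
  assumes "N \<ge> 1"
  shows "saw_num_to N k x * sqrt N ^ weight N x \<le> fact k * sqrt N ^ k"
proof (induction k arbitrary: x)
  case 0
  then show ?case by (simp add: saw_num_to_0 weight_def)
next
  case (Suc k)
  define s where "s = sqrt (real N)"
  have s: "s \<ge> 1" "s * s = real N" using assms by (auto simp: s_def)
  define h where "h = weight N x"
  \<comment> \<open>\<open>a\<close> bounds the term of a predecessor of weight
    \<open>h - 1\<close>, and \<open>b\<close> that of one of weight \<open>h + 1\<close>, which is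
    out of reach if \<open>h > k\<close>. There are \<open>h\<close> of the former and at most
    \<open>N\<close> of the latter, and \<open>N * b = a\<close> if \<open>h <= k\<close>; the total
    is then \<open>(h + 1) * a\<close>.\<close>
  define a where "a = fact k * s ^ Suc k"
  define b where "b = (if h \<le> k then fact k * s ^ k / s else 0)"
  have b0: "b \<ge> 0" using s by (simp add: b_def)
  have term_le: "saw_num_to N k (x + unit_vec i) * s ^ h \<le> (if x i = 1 then a else b)" if "i < N" for i
  proof (cases "x i = 1")
    case True
    then have h: "h = Suc (weight N (x + unit_vec i))" using weight_add_unit_vec[OF that]
      by (simp add: h_def)
    have "saw_num_to N k (x + unit_vec i) * s ^ weight N (x + unit_vec i) * s \<le> fact k * s ^ k * s"
      unfolding s_def by (intro mult_right_mono Suc.IH) simp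
    then show ?thesis using True by (simp add: h a_def mult_ac)
  next
    case False
    then have h: "weight N (x + unit_vec i) = Suc h" using weight_add_unit_vec[OF that]
      by (simp add: h_def)
    show ?thesis
    proof (cases "h \<le> k")
      case True
      have "saw_num_to N k (x + unit_vec i) * s ^ weight N (x + unit_vec i) / s \<le> fact k * s ^ k / s"
        unfolding s_def by (intro divide_right_mono Suc.IH) simp
      then show ?thesis using False True s by (simp add: h b_def)
    next
      case h': False
      then have "saw_num_to N k (x + unit_vec i) = 0"
        using saw_num_to_parity[of N k "x + unit_vec i"] h by auto
      then show ?thesis using False h' by (simp add: b_def)
    qed
  qed
  have "saw_num_to N (Suc k) x * s ^ h \<le> (\<Sum>i<N. saw_num_to N k (x + unit_vec i)) * s ^ h"
    using s by (intro mult_right_mono saw_num_to_Suc_le) simp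
  also have "\<dots> \<le> (\<Sum>i<N. if x i = 1 then a else b)"
    unfolding sum_distrib_right using term_le by (intro sum_mono) simp
  also have "\<dots> \<le> (\<Sum>i<N. (if x i = 1 then a else 0) + b)"
    using b0 by (intro sum_mono) simp
  also have "\<dots> = real h * a + real N * b"
  proof -
    have "{i \<in> {..<N}. x i = 1} = {i. i < N \<and> x i = 1}" by auto
    then show ?thesis by (simp
      add: sum.distrib sum.If_cases h_def weight_def Int_def del: bit_not_one_iff)
  qed
  finally have main: "saw_num_to N (Suc k) x * s ^ h \<le> real h * a + real N * b" .
  have a0: "a \<ge> 0" using s by (simp add: a_def)
  show ?case
  proof (cases "h \<le> k")
    case True
    have "real N * b = a" using s True by (simp add: b_def a_def s(2)[symmetric])
    then have "real h * a + real N * b = (real h + 1) * a" by (simp add: algebra_simps)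
    also have "\<dots> \<le> (real k + 1) * a" using True a0 by (intro mult_right_mono) auto
    finally have "saw_num_to N (Suc k) x * s ^ h \<le> (real k + 1) * a" using main by linarith
    then show ?thesis by (simp add: a_def h_def s_def mult_ac add.commute)
  next
    case False
    show ?thesis
    proof (cases "h = Suc k")
      case True
      then show ?thesis using main by (simp add: a_def b_def h_def s_def mult_ac)
    next
      case False
      then have "saw_num_to N (Suc k) x = 0"
        using saw_num_to_parity[of N "Suc k" x] \<open>\<not> h \<le> k\<close> h_def by auto
      then show ?thesis by simp
    qed
  qed
qed

text \<open>\<open>20643840 = 2 * 8! * 2^8\<close>, from \<open>c_(k-8) <= 2 (N - 1)^(k-8)\<close>, \<open>c_8(x) <= 8! N^4\<close> and \<open>N <= 2 (N - 1)\<close>.\<close>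

definition short_const :: real where "short_const = 20643840"

section \<open>Bounds on \<open>saw_num_to N k x\<close> relative to
  \<open>(N - 1) ^ k\<close>\<close>

context
  fixes N :: nat and p s :: real
  assumes N: "N \<ge> 2"
  defines "p \<equiv> real N - 1" and "s \<equiv> sqrt (real N)"
begin

lemma sqrt_degree_bounds: "s \<ge> 1" "s * s = real N" "real N \<le> 2 * p" "p \<ge> 1"
  using N by (auto simp: p_def s_def)

lemma s_power: "s ^ (2 * k) \<le> 2 ^ k * p ^ k"
proof -
  have "s ^ (2 * k) = real N ^ k" by (simp add: power_mult power2_eq_square sqrt_degree_bounds)
  also have "\<dots> \<le> (2 * p) ^ k" using sqrt_degree_bounds by (intro power_mono) auto
  finally show ?thesis by (simp add: power_mult_distrib)
qed

lemma fact_le_5040: "k \<le> 7 \<Longrightarrow> (fact k :: real) \<le> 5040"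
  using fact_mono[of k 7, where 'a = real] by (simp add: fact_numeral)

text \<open>A nonzero endpoint has weight at least 1, which gains one factor \<open>s\<close>; the
  origin is never revisited. \<open>5040 = 7!\<close>.\<close>

lemma saw_num_to_short':
  assumes "1 \<le> k" "k \<le> 7" "x \<in> cube N"
  shows "saw_num_to N k x \<le> 5040 * s ^ (k - 1)"
proof (cases "x = 0")
  case True
  then show ?thesis using saw_num_to_zero[of k N] assms sqrt_degree_bounds by simp
next
  case False
  then have "weight N x \<ge> 1" using weight_0_iff[OF assms(3)] by (simp add: Suc_le_eq)
  then have "s ^ 1 \<le> s ^ weight N x" using sqrt_degree_bounds by (intro power_increasing) auto
  then have "saw_num_to N k x * s \<le> saw_num_to N k x * s ^ weight N x"
    by (intro mult_left_mono saw_num_to_nonneg) auto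
  also have "\<dots> \<le> fact k * s ^ k" using saw_num_to_short[of N k x] N by (simp add: s_def)
  also have "\<dots> \<le> 5040 * s ^ k" using fact_le_5040[OF assms(2)] sqrt_degree_bounds
    by (intro mult_right_mono) auto
  also have "s ^ k = s ^ (k - 1) * s" using assms(1) by (cases k) auto
  finally show ?thesis using sqrt_degree_bounds by simp
qed

lemma saw_num_to_unif_short:
  assumes "1 \<le> k" "k \<le> 7"
  shows "saw_num_to N k x \<le> short_const / real N * p ^ k"
proof (cases "x \<in> cube N")
  case True
  have "saw_num_to N k x * real N \<le> 5040 * s ^ (k - 1) * real N"
    using saw_num_to_short'[OF assms True] by (intro mult_right_mono) auto
  also have "\<dots> = 5040 * s ^ (k - 1 + 2)" unfolding sqrt_degree_bounds(2)[symmetric]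
    by (simp add: power_add power2_eq_square)
  also have "\<dots> \<le> 5040 * s ^ (2 * k)" using sqrt_degree_bounds(1) assms
    by (intro mult_left_mono power_increasing) auto
  also have "\<dots> \<le> 5040 * (2 ^ k * p ^ k)" by (intro mult_left_mono s_power) auto
  also have "\<dots> \<le> 5040 * (2 ^ 7 * p ^ k)" using assms sqrt_degree_bounds(4)
    by (intro mult_left_mono mult_right_mono power_increasing) auto
  also have "\<dots> \<le> short_const * p ^ k" using sqrt_degree_bounds(4) by (simp add: short_const_def)
  finally show ?thesis using N by (simp add: field_simps)
qed (use sqrt_degree_bounds in \<open>simp add: saw_num_to_outside short_const_def\<close>)

text \<open>Gaining two factors \<open>N\<close> requires \<open>k + 3 <= 2 * k\<close>, that is
  \<open>k >= 3\<close>; the value \<open>k = 2\<close> is impossible by parity. This is the cost of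
  reaching a given neighbour of the origin by a detour, that is of closing a loop.\<close>

lemma saw_num_to_unif_unit:
  assumes "2 \<le> k" "k \<le> 7" "weight N x = 1" "x \<in> cube N"
  shows "saw_num_to N k x \<le> short_const / real N ^ 2 * p ^ k"
proof (cases "k = 2")
  case True
  then have "saw_num_to N k x = 0" using saw_num_to_parity[of N k x] assms(3) by auto
  then show ?thesis using sqrt_degree_bounds by (simp add: short_const_def)
next
  case False
  have "saw_num_to N k x * real N ^ 2 \<le> 5040 * s ^ (k - 1) * real N ^ 2"
    using saw_num_to_short'[OF _ assms(2,4)] assms(1) by (intro mult_right_mono) auto
  also have "\<dots> = 5040 * s ^ (k - 1 + 4)" unfolding sqrt_degree_bounds(2)[symmetric]
    by (simp add: power_add power2_eq_square eval_nat_numeral)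
  also have "\<dots> \<le> 5040 * s ^ (2 * k)" using sqrt_degree_bounds(1) assms(1) False
    by (intro mult_left_mono power_increasing) auto
  also have "\<dots> \<le> 5040 * (2 ^ k * p ^ k)" by (intro mult_left_mono s_power) auto
  also have "\<dots> \<le> 5040 * (2 ^ 7 * p ^ k)" using assms sqrt_degree_bounds(4)
    by (intro mult_left_mono mult_right_mono power_increasing) auto
  also have "\<dots> \<le> short_const * p ^ k" using sqrt_degree_bounds(4) by (simp add: short_const_def)
  finally show ?thesis using N by (simp add: field_simps)
qed

text \<open>The last eight steps have at most \<open>8! * N ^ 4\<close> realisations whatever their
  displacement, against about \<open>N ^ 8\<close> unrestricted ones; the first \<open>k - 8\<close>
  steps are counted without regard to their endpoint.\<close>

lemma saw_num_to_unif_long: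
  assumes "8 \<le> k"
  shows "saw_num_to N k x \<le> short_const / real N ^ 4 * p ^ k"
proof (cases "x \<in> cube N")
  case True
  obtain l where l: "k = l + 8" using assms le_Suc_ex by (metis add.commute)
  have c8: "saw_num_to N 8 y \<le> 40320 * real N ^ 4" for y
  proof -
    have "saw_num_to N 8 y * 1 \<le> saw_num_to N 8 y * s ^ weight N y"
      using sqrt_degree_bounds(1) by (intro mult_left_mono saw_num_to_nonneg) auto
    also have "\<dots> \<le> fact 8 * s ^ (2 * 4)" using saw_num_to_short[of N 8 y] N by (simp add: s_def)
    also have "s ^ (2 * 4) = real N ^ 4" unfolding power_mult
      by (simp add: power2_eq_square sqrt_degree_bounds(2))
    finally show ?thesis by (simp add: fact_numeral)
  qed
  have "saw_num_to N k x \<le> (\<Sum>y\<in>cube N. saw_num_to N l y * saw_num_to N 8 (x - y))" unfolding l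
    by (rule saw_num_to_submult)
  also have "\<dots> \<le> (\<Sum>y\<in>cube N. saw_num_to N l y * (40320 * real N ^ 4))"
    by (intro sum_mono mult_left_mono c8 saw_num_to_nonneg)
  also have "\<dots> = saw_num N l * (40320 * real N ^ 4)" by (simp add: saw_num_eq_sum sum_distrib_right)
  also have "\<dots> \<le> 2 * p ^ l * (40320 * real N ^ 4)"
    using saw_num_le[OF N, of l] by (intro mult_right_mono) (auto simp: p_def)
  finally have "saw_num_to N k x * real N ^ 4 \<le> 2 * p ^ l * (40320 * real N ^ 4) * real N ^ 4"
    by (intro mult_right_mono) auto
  also have "\<dots> = p ^ l * 80640 * real N ^ 8" by (simp flip: power_add)
  also have "\<dots> \<le> p ^ l * 80640 * (2 * p) ^ 8" using sqrt_degree_bounds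
    by (intro mult_left_mono power_mono) auto
  also have "\<dots> = short_const * p ^ k" by (simp add: short_const_def l power_add power_mult_distrib)
  finally show ?thesis using N by (simp add: field_simps)
qed (use sqrt_degree_bounds in \<open>simp add: saw_num_to_outside short_const_def\<close>)

end

section \<open>Walks up to the mixing time\<close>

lemma saw_num_to_1_le:
  assumes "N \<ge> 1" "x \<noteq> 0"
  shows "saw_num_to N 1 x \<le> of_bool (weight N x = 1)"
proof (cases "weight N x = 1")
  case True
  then have "saw_num_to N 1 x * sqrt (real N) \<le> 1 * sqrt (real N)"
    using saw_num_to_short[of N 1 x] assms by simp
  then show ?thesis using True assms by simp
next
  case False
  have "saw_num_to N 1 x = 0"
  proof (rule ccontr)
    assume "saw_num_to N 1 x \<noteq> 0"
    from saw_num_to_parity[OF this] have "weight N x = 1" by (cases "weight N x") auto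
    then show False using False by simp
  qed
  then show ?thesis using False by simp
qed

text \<open>\<open>saw_num_supermult\<close> with a single step as the second walk. It fails if the
  long walk visits the neighbour \<open>x\<close>: at time 1 this is a reversal, which gives
  \<open>saw_num N (k - 1)\<close>; at a later time a loop is closed.\<close>

lemma saw_num_recursion_lower:
  assumes N: "N \<ge> 2" and k: "1 \<le> k" "k \<le> N ^ 2"
  shows "real N * saw_num N k \<le> saw_num N (Suc k) + real N * saw_num N (k - 1) +
    real N * (2 * (real N - 1) ^ k * (7 * short_const / real N ^ 2))"
proof -
  define p where "p = real N - 1"
  define R where "R = 2 * p ^ k * (7 * short_const / real N ^ 2)"
  have p: "p \<ge> 1" using N by (simp add: p_def)
  have R0: "R \<ge> 0" using p by (simp add: R_def short_const_def)
  \<comment> \<open>The six times 2 to 7 cost \<open>short_const / N ^ 2\<close> each; the at most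
    \<open>N ^ 2\<close> remaining times cost \<open>short_const / N ^ 4\<close> each and together
    add a seventh such term.\<close>
  have tail: "(\<Sum>i=2..k. saw_num_to N i x * saw_num N (k - i)) \<le> R" if x: "weight N x = 1" "x \<in> cube N"
    for x
  proof -
    have "(\<Sum>i=2..k. saw_num_to N i x * saw_num N (k - i)) \<le>
      (\<Sum>i=2..k. 2 * p ^ k * ((if i \<in> {2..7} then short_const / real N ^ 2 else 0)
        + short_const / real N ^ 4))"
    proof (rule sum_mono)
      fix i assume i: "i \<in> {2..k}"
      have "saw_num_to N i x \<le> ((if i \<in> {2..7} then short_const / real N ^ 2 else 0)
        + short_const / real N ^ 4) * p ^ i"
      proof (cases "i \<le> 7")
        case True
        have "saw_num_to N i x \<le> short_const / real N ^ 2 * p ^ i"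
          using saw_num_to_unif_unit[OF N, of i x] x True i by (simp add: p_def)
        also have "\<dots> \<le> (short_const / real N ^ 2 + short_const / real N ^ 4) * p ^ i"
          using p by (intro mult_right_mono) (auto simp: short_const_def)
        finally show ?thesis using True i by simp
      next
        case False
        then show ?thesis using saw_num_to_unif_long[OF N, of i x] by (simp add: p_def)
      qed
      moreover have "saw_num N (k - i) \<le> 2 * p ^ (k - i)" unfolding p_def by (rule saw_num_le[OF N])
      ultimately have "saw_num_to N i x * saw_num N (k - i) \<le>
          (((if i \<in> {2..7} then short_const / real N ^ 2 else 0)
            + short_const / real N ^ 4) * p ^ i) * (2 * p ^ (k - i))"
        using p by (intro mult_mono saw_num_nonneg) (auto simp: short_const_def)
      also have "\<dots> = 2 * (p ^ i * p ^ (k - i)) * ((if i \<in> {2..7} then short_const / real N ^ 2 else 0)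
        + short_const / real N ^ 4)"
        by (simp only: mult_ac)
      also have "p ^ i * p ^ (k - i) = p ^ k" using i by (simp flip: power_add)
      finally show "saw_num_to N i x * saw_num N (k - i) \<le>
         2 * p ^ k * ((if i \<in> {2..7} then short_const / real N ^ 2 else 0) + short_const / real N ^ 4)" .
    qed
    also have "\<dots> = 2 * p ^ k * (real (card ({2..k} \<inter> {2..7})) * (short_const / real N ^ 2) + real (k
      - 1) * (short_const / real N ^ 4))"
      unfolding sum_distrib_left[symmetric] sum.distrib sum.inter_restrict[OF finite_atLeastAtMost, symmetric]
      by simp
    also have "\<dots> \<le> 2 * p ^ k * (6 * (short_const / real N ^ 2)
      + real N ^ 2 * (short_const / real N ^ 4))"
    proof (intro mult_left_mono add_mono mult_right_mono)
      have "card ({2..k} \<inter> {2..7}) \<le> card {2..7::nat}" by (intro card_mono) auto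
      then show "real (card ({2..k} \<inter> {2..7})) \<le> 6" by simp
      have "real (k - 1) \<le> real (N ^ 2)" using k by (intro of_nat_mono) linarith
      then show "real (k - 1) \<le> real N ^ 2" by (simp only: of_nat_power)
    qed (use p in \<open>auto simp: short_const_def\<close>)
    also have "\<dots> = R" using N by (simp add: R_def field_simps power2_eq_square eval_nat_numeral)
    finally show ?thesis .
  qed
  have c1: "saw_num_to N 0 x = 0" if "x \<noteq> 0" for x using that by (simp add: saw_num_to_0)
  have "saw_num N k * saw_num N 1 \<le> saw_num N (k + 1) + (\<Sum>x\<in>cube N - {0}. hit N k x * hit N 1 x)"
    by (rule saw_num_supermult)
  also have "(\<Sum>x\<in>cube N - {0}. hit N k x * hit N 1 x) \<le> (\<Sum>x\<in>cube N - {0}. (saw_num N (k - 1)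
    + R) * saw_num_to N 1 x)"
  proof (rule sum_mono)
    fix x assume x: "x \<in> cube N - {0}"
    have h1: "hit N 1 x = saw_num_to N 1 x" using x by (simp add: hit_def c1 saw_num_def saw_count_0)
    show "hit N k x * hit N 1 x \<le> (saw_num N (k - 1) + R) * saw_num_to N 1 x"
    proof (cases "weight N x = 1")
      case True
      have "{..k} = {0, 1} \<union> {2..k}" using k by auto
      then have "hit N k x = saw_num_to N 1 x * saw_num N (k - 1)
        + (\<Sum>i=2..k. saw_num_to N i x * saw_num N (k - i))"
        using x by (simp add: hit_def sum.union_disjoint c1)
      also have "\<dots> \<le> 1 * saw_num N (k - 1) + R"
        using tail[OF True] x saw_num_to_1_le[of N x] N True
          by (intro add_mono mult_right_mono saw_num_nonneg) auto
      finally show ?thesis unfolding h1 by (intro mult_right_mono saw_num_to_nonneg) simp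
    next
      case False
      then have "saw_num_to N 1 x = 0"
        using saw_num_to_1_le[of N x] saw_num_to_nonneg[of N 1 x] x N by simp
      then show ?thesis by (simp only: h1)
    qed
  qed
  also have "\<dots> \<le> (\<Sum>x\<in>cube N. (saw_num N (k - 1) + R) * saw_num_to N 1 x)"
    using R0 by (intro sum_mono2 finite_cube) (auto intro!:
      mult_nonneg_nonneg saw_num_to_nonneg add_nonneg_nonneg saw_num_nonneg)
  also have "\<dots> = (saw_num N (k - 1) + R) * real N"
    by (simp add: sum_distrib_left[symmetric] saw_num_eq_sum[symmetric] saw_num_1)
  finally show ?thesis unfolding p_def[symmetric] R_def[symmetric] by (simp add: saw_num_1 algebra_simps)
qed

text \<open>For \<open>a k = saw_num N k / p ^ k\<close> the recursion bounds each increment below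
  by the previous one divided by \<open>p\<close>, minus \<open>e\<close>. Since
  \<open>p >= 2\<close>, no increment falls below \<open>- 2 * e\<close>, so the loss after
  \<open>m\<close> steps is at most \<open>2 * e * m\<close>.\<close>

lemma saw_num_lower:
  assumes N: "N \<ge> 3" and m: "m \<le> N ^ 2"
  shows "(1 - 58 * short_const * real m / real N ^ 2) * (real N - 1) ^ m \<le> saw_num N m"
proof -
  define p where "p = real N - 1"
  have p: "p \<ge> 2" using N by (simp add: p_def)
  have Np: "real N = p + 1" by (simp add: p_def)
  define a where "a = (\<lambda>k. saw_num N k / p ^ k)"
  define e where "e = 29 * short_const / real N ^ 2"
  have a2: "a k \<le> 2" for k
    using saw_num_le[of N k] N p by (simp add: a_def p_def[symmetric] field_simps)
  have step: "a (Suc k) - a k \<ge> (a k - a (k - 1)) / p - e" if k: "1 \<le> k" "k \<le> N ^ 2" for k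
  proof -
    obtain l where l: "k = Suc l" using k(1) by (cases k) auto
    have t: "saw_num N k = a k * p ^ k" for k using p by (simp add: a_def)
    define c where "c = 14 * short_const / real N ^ 2"
    have c2: "2 * p ^ k * (7 * short_const / real N ^ 2) = c * p ^ k" by (simp add: c_def)
    have "real N * saw_num N k \<le> saw_num N (Suc k) + real N * saw_num N (k - 1)
      + real N * (2 * p ^ k * (7 * short_const / real N ^ 2))"
      unfolding p_def by (rule saw_num_recursion_lower) (use N k in auto)
    then have "p ^ l * (real N * (a k * p)) \<le> p ^ l * (a (Suc k) * p\<^sup>2 + real N * a l
      + real N * (c * p))"
      unfolding t c2 by (simp add: l power2_eq_square algebra_simps)
    then have *: "real N * (a k * p) \<le> a (Suc k) * p\<^sup>2 + real N * a l + real N * (c * p)"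
      using p by simp
    \<comment> \<open>The coefficient of \<open>a l\<close> is \<open>p = N - 1\<close> on the left
      but \<open>N\<close> in the recursion; the difference \<open>a l\<close> is at most 2.\<close>
    have "(a (Suc k) - a k - (a k - a l) / p) * p\<^sup>2 = a (Suc k) * p\<^sup>2 + real N * a l
      - real N * (a k * p) - a l"
      using p by (simp add: Np field_simps power2_eq_square)
    also have "\<dots> \<ge> - (real N * (c * p)) - 2" using * a2[of l] by linarith
    finally have "- (real N * (c * p)) - 2 \<le> (a (Suc k) - a k - (a k - a l) / p) * p\<^sup>2" .
    then have "(- (real N * (c * p)) - 2) / p\<^sup>2 \<le> a (Suc k) - a k - (a k - a l) / p"
      using p by (simp add: pos_divide_le_eq)
    moreover have "(- (real N * (c * p)) - 2) / p\<^sup>2 = - (real N / p * c) - 2 * (1 / p)\<^sup>2"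
      using p by (simp add: power2_eq_square field_simps)
    moreover have "real N / p * c \<le> 2 * c"
    proof (rule mult_right_mono)
      show "real N / p \<le> 2" using p Np by (simp add: field_simps)
    qed (simp add: c_def short_const_def)
    moreover have "(1 / p)\<^sup>2 \<le> (2 / real N)\<^sup>2"
      using p Np by (intro power_mono) (auto simp: field_simps)
    moreover have "2 * c + 2 * (2 / real N)\<^sup>2 \<le> e"
      using N by (simp add: c_def e_def power_divide divide_simps short_const_def)
    ultimately show ?thesis unfolding l by simp
  qed
  have e0: "e \<ge> 0" by (simp add: e_def short_const_def)
  have D: "a (Suc k) - a k \<ge> - 2 * e" if "k \<le> N ^ 2" for k
    using that
  proof (induction k)
    case 0
    have "a (Suc 0) - a 0 = 1 / p" using p
      by (simp add: a_def saw_num_1 saw_num_def[of N 0] saw_count_0 Np field_simps)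
    moreover have "1 / p \<ge> 0" using p by simp
    ultimately show ?case using e0 by linarith
  next
    case (Suc k)
    have "(a (Suc k) - a k) / p \<ge> (- 2 * e) / p"
      using Suc p by (intro divide_right_mono) auto
    moreover have "(- 2 * e) / p \<ge> - e" using p e0 by (simp add: field_simps mult_left_mono)
    ultimately show ?case using step[of "Suc k"] Suc.prems by simp
  qed
  have "a k \<ge> 1 - 2 * e * real k" if "k \<le> N ^ 2" for k
    using that
  proof (induction k)
    case (Suc k)
    then show ?case using D[of k] by (simp add: algebra_simps)
  qed (simp add: a_def saw_num_def saw_count_0)
  from this[OF m] have "1 - 58 * short_const * real m / real N ^ 2 \<le> saw_num N m / p ^ m"
    by (simp add: a_def e_def)
  then show ?thesis using p by (simp add: p_def[symmetric] pos_le_divide_eq)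
qed

text \<open>The two-point function at \<open>z = 1 / (N - 1)\<close>, truncated after
  \<open>m\<close> steps and without the zero-step term.\<close>

definition green_short :: "nat \<Rightarrow> nat \<Rightarrow> (nat \<Rightarrow> bit) \<Rightarrow> real" where
  "green_short N m x = (\<Sum>i=1..m. saw_num_to N i x / (real N - 1) ^ i)"

lemma sum_saw_num_to_div_le:
  assumes "N \<ge> 2"
  shows "(\<Sum>x\<in>cube N. saw_num_to N i x / (real N - 1) ^ i) \<le> 2"
  using saw_num_le[OF assms, of i] assms
  by (simp add: sum_divide_distrib[symmetric] saw_num_eq_sum[symmetric] pos_divide_le_eq)

lemma green_short_sum:
  assumes "N \<ge> 2"
  shows "(\<Sum>x\<in>cube N. green_short N m x) \<le> 2 * real m"
proof -
  have "(\<Sum>x\<in>cube N. green_short N m x) = (\<Sum>i=1..m. \<Sum>x\<in>cube N. saw_num_to N i x / (real N - 1) ^ i)"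
    unfolding green_short_def by (rule sum.swap)
  also have "\<dots> \<le> (\<Sum>i=1..m. 2)" by (intro sum_mono sum_saw_num_to_div_le assms)
  finally show ?thesis by simp
qed

lemma green_short_nonneg: "N \<ge> 2 \<Longrightarrow> green_short N m x \<ge> 0"
  unfolding green_short_def by (intro sum_nonneg divide_nonneg_nonneg saw_num_to_nonneg) simp

text \<open>Walks of at most 7 steps form \<open>A\<close>, the longer ones \<open>B\<close>. Each
  sum of squares is bounded by supremum times total mass: \<open>7 * short_const / N\<close> times
  14 for \<open>A\<close>, and \<open>m * short_const / N ^ 4\<close> times \<open>2 * m\<close> for
  \<open>B\<close>, which \<open>m ^ 2 <= N ^ 3\<close> brings down to order
  \<open>1 / N\<close>.\<close>

lemma green_short_square_sum:
  assumes N: "N \<ge> 2" and m: "m ^ 2 \<le> N ^ 3"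
  shows "(\<Sum>x\<in>cube N. (green_short N m x)\<^sup>2) \<le> 200 * short_const / real N"
proof -
  define q where "q = (\<lambda>i x. saw_num_to N i x / (real N - 1) ^ i)"
  define A where "A = (\<lambda>x. \<Sum>i\<in>{1..m} \<inter> {..7}. q i x)"
  define B where "B = (\<lambda>x. \<Sum>i\<in>{1..m} - {..7}. q i x)"
  have q0: "q i x \<ge> 0" for i x using N by (simp add: q_def saw_num_to_nonneg)
  have A0: "A x \<ge> 0" and B0: "B x \<ge> 0" for x by (auto simp: A_def B_def intro!: sum_nonneg q0)
  have cA: "card ({1..m} \<inter> {..7}) \<le> 7"
    using card_mono[of "{1..7}" "{1..m} \<inter> {..7}"] by auto
  have cB: "card ({1..m} - {..7}) \<le> m"
    using card_mono[of "{1..m}" "{1..m} - {..7}"] by auto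
  have AB: "green_short N m x = A x + B x" for x
    unfolding green_short_def A_def B_def q_def
    by (subst sum.union_disjoint[symmetric]) (auto intro!: sum.cong)
  have sumq: "(\<Sum>x\<in>cube N. q i x) \<le> 2" for i unfolding q_def by (rule sum_saw_num_to_div_le[OF N])
  have A1: "A x \<le> 7 * (short_const / real N)" for x
  proof -
    have "A x \<le> (\<Sum>i\<in>{1..m} \<inter> {..7}. short_const / real N)" unfolding A_def
      using saw_num_to_unif_short[OF N, of _ x] N by (intro sum_mono) (auto simp: q_def pos_divide_le_eq)
    also have "\<dots> = real (card ({1..m} \<inter> {..7})) * (short_const / real N)" by simp
    also have "\<dots> \<le> 7 * (short_const / real N)" using cA
      by (intro mult_right_mono) (auto simp: short_const_def)
    finally show ?thesis .
  qed
  have B1: "B x \<le> real m * (short_const / real N ^ 4)" for x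
  proof -
    have "B x \<le> (\<Sum>i\<in>{1..m} - {..7}. short_const / real N ^ 4)" unfolding B_def
      using saw_num_to_unif_long[OF N, of _ x] N by (intro sum_mono) (auto simp: q_def pos_divide_le_eq)
    also have "\<dots> = real (card ({1..m} - {..7})) * (short_const / real N ^ 4)" by simp
    also have "\<dots> \<le> real m * (short_const / real N ^ 4)" using cB
      by (intro mult_right_mono) (auto simp: short_const_def)
    finally show ?thesis .
  qed
  have sA: "(\<Sum>x\<in>cube N. A x) \<le> 14"
  proof -
    have "(\<Sum>x\<in>cube N. A x) = (\<Sum>i\<in>{1..m} \<inter> {..7}. \<Sum>x\<in>cube N. q i x)" unfolding A_def by (rule sum.swap)
    also have "\<dots> \<le> (\<Sum>i\<in>{1..m} \<inter> {..7}. 2)" by (intro sum_mono sumq)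
    finally show ?thesis using cA by simp
  qed
  have sB: "(\<Sum>x\<in>cube N. B x) \<le> 2 * real m"
  proof -
    have "(\<Sum>x\<in>cube N. B x) = (\<Sum>i\<in>{1..m} - {..7}. \<Sum>x\<in>cube N. q i x)" unfolding B_def by (rule sum.swap)
    also have "\<dots> \<le> (\<Sum>i\<in>{1..m} - {..7}. 2)" by (intro sum_mono sumq)
    also have "\<dots> \<le> 2 * real m" using cB by simp
    finally show ?thesis .
  qed
  have "(\<Sum>x\<in>cube N. (green_short N m x)\<^sup>2) \<le> (\<Sum>x\<in>cube N. 2 * (A x * (7 * (short_const / real N)))
    + 2 * (B x * (real m * (short_const / real N ^ 4))))"
  proof (rule sum_mono)
    fix x
    have "(A x + B x)\<^sup>2 \<le> 2 * (A x * A x) + 2 * (B x * B x)"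
      using zero_le_power2[of "A x - B x"] by (simp add: power2_eq_square algebra_simps)
    also have "\<dots> \<le> 2 * (A x * (7 * (short_const / real N)))
      + 2 * (B x * (real m * (short_const / real N ^ 4)))"
      by (intro add_mono mult_left_mono A1 B1 A0 B0) auto
    finally show "(green_short N m x)\<^sup>2 \<le> 2 * (A x * (7 * (short_const / real N)))
      + 2 * (B x * (real m * (short_const / real N ^ 4)))"
      by (simp only: AB)
  qed
  also have "\<dots> = 2 * ((\<Sum>x\<in>cube N. A x) * (7 * (short_const / real N)))
    + 2 * ((\<Sum>x\<in>cube N. B x) * (real m * (short_const / real N ^ 4)))"
    by (simp only: sum.distrib sum_distrib_left[symmetric] sum_distrib_right[symmetric])
  also have "\<dots> \<le> 2 * (14 * (7 * (short_const / real N)))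
    + 2 * ((2 * real m) * (real m * (short_const / real N ^ 4)))"
    by (intro add_mono mult_left_mono mult_right_mono sA sB) (auto simp: short_const_def)
  also have "\<dots> = 196 * (short_const / real N) + 4 * (real (m ^ 2) * (short_const / real N ^ 4))"
    by (simp add: power2_eq_square)
  also have "\<dots> \<le> 196 * (short_const / real N) + 4 * (real (N ^ 3) * (short_const / real N ^ 4))"
    using m by (intro add_mono mult_left_mono mult_right_mono order_refl) (auto
      simp: short_const_def simp flip: of_nat_power)
  also have "\<dots> = 200 * short_const / real N" using N by (simp add: field_simps eval_nat_numeral)
  finally show ?thesis .
qed

section \<open>The bootstrap\<close>

definition green :: "nat \<Rightarrow> real \<Rightarrow> (nat \<Rightarrow> bit) \<Rightarrow> real" where
  "green N z x = (\<Sum>n<vol N. saw_num_to N n x * z ^ n)"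

lemma susceptibility_eq: "susceptibility N z = (\<Sum>n<vol N. saw_num N n * z ^ n)"
proof -
  have "{0..vol N - 1} = {..<vol N}" using vol_pos[of N] by auto
  then show ?thesis by (simp add: susceptibility_def saw_num_def)
qed

lemma saw_num_ge_vol: "vol N \<le> n \<Longrightarrow> saw_num N n = 0"
  by (simp add: saw_num_def saw_count_ge_vol)

lemma
  fixes f :: "nat \<Rightarrow> nat \<Rightarrow> real"
  assumes "\<And>i j. f i j \<ge> 0"
  shows triangle_sum_le: "(\<Sum>n<V. \<Sum>i\<le>n. f i (n - i)) \<le> (\<Sum>i<V. \<Sum>j<V. f i j)"
    and triangle_sum_eq: "(\<And>i j. i + j \<ge> V \<Longrightarrow> f i j = 0) \<Longrightarrow>
      (\<Sum>i<V. \<Sum>j<V. f i j) = (\<Sum>n<V. \<Sum>i\<le>n. f i (n - i))"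
proof -
  have tri: "(\<Sum>(i,j)\<in>{(i,j). i + j < V}. f i j) = (\<Sum>n<V. \<Sum>i\<le>n. f i (n - i))"
    by (rule sum.triangle_reindex)
  have sq: "(\<Sum>i<V. \<Sum>j<V. f i j) = (\<Sum>(i,j)\<in>{..<V} \<times> {..<V}. f i j)"
    by (rule sum.cartesian_product)
  have sub: "{(i,j). i + j < V} \<subseteq> {..<V} \<times> {..<V}" by auto
  show "(\<Sum>n<V. \<Sum>i\<le>n. f i (n - i)) \<le> (\<Sum>i<V. \<Sum>j<V. f i j)"
    unfolding tri[symmetric] sq by (rule sum_mono2) (use sub assms in auto)
  assume z: "\<And>i j. i + j \<ge> V \<Longrightarrow> f i j = 0"
  show "(\<Sum>i<V. \<Sum>j<V. f i j) = (\<Sum>n<V. \<Sum>i\<le>n. f i (n - i))"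
    unfolding tri[symmetric] sq by (rule sum.mono_neutral_right) (use sub in \<open>auto, metis z not_less\<close>)
qed

lemma hit_nonneg: "hit N m x \<ge> 0"
  unfolding hit_def by (intro sum_nonneg mult_nonneg_nonneg saw_num_to_nonneg saw_num_nonneg)

lemma green_nonneg: "z \<ge> 0 \<Longrightarrow> green N z x \<ge> 0"
  unfolding green_def by (intro sum_nonneg mult_nonneg_nonneg saw_num_to_nonneg) simp

text \<open>\<open>hit\<close> is a convolution, so its generating function is a product, up to the
  truncation at \<open>vol N\<close>.\<close>

lemma hit_generating_le:
  assumes "z \<ge> 0"
  shows "(\<Sum>n<vol N. hit N n x * z ^ n) \<le> green N z x * susceptibility N z"
proof -
  define f where "f = (\<lambda>i j. (saw_num_to N i x * z ^ i) * (saw_num N j * z ^ j))"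
  have "hit N n x * z ^ n = (\<Sum>i\<le>n. f i (n - i))" for n
    unfolding hit_def sum_distrib_right
  proof (rule sum.cong[OF refl])
    fix i assume "i \<in> {..n}"
    then have "z ^ n = z ^ i * z ^ (n - i)" by (simp flip: power_add)
    then show "saw_num_to N i x * saw_num N (n - i) * z ^ n = f i (n - i)" by (simp add: f_def)
  qed
  then have "(\<Sum>n<vol N. hit N n x * z ^ n) = (\<Sum>n<vol N. \<Sum>i\<le>n. f i (n - i))" by simp
  also have "\<dots> \<le> (\<Sum>i<vol N. \<Sum>j<vol N. f i j)"
    by (rule triangle_sum_le) (auto simp: f_def intro!:
      mult_nonneg_nonneg saw_num_to_nonneg saw_num_nonneg simp: assms)
  also have "\<dots> = green N z x * susceptibility N z"
    by (simp add: f_def green_def susceptibility_eq sum_product)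
  finally show ?thesis .
qed

text \<open>The factor \<open>n + 1\<close> counts the times at which an \<open>n\<close>-step walk
  can be cut in two.\<close>

lemma length_sum_le:
  assumes "z \<ge> 0"
  shows "(\<Sum>n<vol N. real (n + 1) * (saw_num N n * z ^ n)) \<le> (susceptibility N z)\<^sup>2"
proof -
  have "(\<Sum>n<vol N. real (n + 1) * (saw_num N n * z ^ n)) = (\<Sum>n<vol N. \<Sum>i\<le>n. saw_num N (i + (n
    - i)) * z ^ (i + (n - i)))"
    by simp
  also have "\<dots> \<le> (\<Sum>n<vol N. \<Sum>i\<le>n. (saw_num N i * z ^ i) * (saw_num N (n - i) * z ^ (n - i)))"
  proof (intro sum_mono)
    fix n i :: nat
    have "saw_num N (i + (n - i)) * z ^ (i + (n - i)) \<le> saw_num N i * saw_num N (n - i) * z ^ (i + (n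
      - i))"
      using assms by (intro mult_right_mono saw_num_submult) simp
    then show "saw_num N (i + (n - i)) * z ^ (i + (n - i)) \<le> (saw_num N i * z ^ i) * (saw_num N (n
      - i) * z ^ (n - i))"
      by (simp only: power_add mult_ac)
  qed
  also have "\<dots> \<le> (\<Sum>i<vol N. \<Sum>j<vol N. (saw_num N i * z ^ i) * (saw_num N j * z ^ j))"
    by (rule triangle_sum_le) (auto intro!: mult_nonneg_nonneg saw_num_nonneg simp: assms)
  also have "\<dots> = (susceptibility N z)\<^sup>2"
    by (simp add: susceptibility_eq power2_eq_square sum_product)
  finally show ?thesis .
qed

lemma saw_num_supermult_weighted:
  assumes "z \<ge> 0"
  shows "(saw_num N m * z ^ m) * (saw_num N n * z ^ n) \<le> saw_num N (m + n) * z ^ (m + n) +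
    (\<Sum>x\<in>cube N - {0}. (hit N m x * z ^ m) * (hit N n x * z ^ n))"
proof -
  have "(saw_num N m * z ^ m) * (saw_num N n * z ^ n) = saw_num N m * saw_num N n * z ^ (m + n)"
    by (simp add: power_add)
  also have "\<dots> \<le> (saw_num N (m + n) + (\<Sum>x\<in>cube N - {0}. hit N m x * hit N n x)) * z ^ (m + n)"
    using assms by (intro mult_right_mono saw_num_supermult) simp
  also have "\<dots> = saw_num N (m + n) * z ^ (m + n) + (\<Sum>x\<in>cube N - {0}. hit N m x * hit N n x * z ^ (m
    + n))"
    by (simp only: distrib_right sum_distrib_right)
  also have "(\<Sum>x\<in>cube N - {0}. hit N m x * hit N n x * z ^ (m + n)) =
    (\<Sum>x\<in>cube N - {0}. (hit N m x * z ^ m) * (hit N n x * z ^ n))"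
    by (intro sum.cong refl) (simp add: power_add)
  finally show ?thesis .
qed

text \<open>\<open>saw_num_supermult\<close> is summed over all pairs of lengths. A total length
  \<open>n\<close> arises from \<open>n + 1\<close> pairs, and nothing is lost by truncation since
  counts vanish from \<open>vol N\<close> on. Each meeting point \<open>x\<close> costs at most
  \<open>green N z x * chi\<close> for either walk.\<close>

lemma length_sum_ge:
  assumes z: "z \<ge> 0"
  shows "(susceptibility N z)\<^sup>2 * (1 - (\<Sum>x\<in>cube N - {0}. (green N z x)\<^sup>2))
    \<le> (\<Sum>n<vol N. real (n + 1) * (saw_num N n * z ^ n))"
proof -
  let ?V = "{..<vol N}" and ?\<chi> = "susceptibility N z" and ?C = "cube N - {0}"
  have "?\<chi>\<^sup>2 = (\<Sum>m\<in>?V. \<Sum>n\<in>?V. (saw_num N m * z ^ m) * (saw_num N n * z ^ n))"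
    by (simp add: susceptibility_eq power2_eq_square sum_product)
  also have "\<dots> \<le> (\<Sum>m\<in>?V. \<Sum>n\<in>?V. saw_num N (m + n) * z ^ (m + n) +
      (\<Sum>x\<in>?C. (hit N m x * z ^ m) * (hit N n x * z ^ n)))"
    by (intro sum_mono saw_num_supermult_weighted z)
  also have "\<dots> = (\<Sum>m\<in>?V. \<Sum>n\<in>?V. saw_num N (m + n) * z ^ (m + n)) +
      (\<Sum>m\<in>?V. \<Sum>n\<in>?V. \<Sum>x\<in>?C. (hit N m x * z ^ m) * (hit N n x * z ^ n))"
    by (simp add: sum.distrib)
  also have "(\<Sum>m\<in>?V. \<Sum>n\<in>?V. \<Sum>x\<in>?C. (hit N m x * z ^ m) * (hit N n x * z ^ n)) =
      (\<Sum>x\<in>?C. \<Sum>m\<in>?V. \<Sum>n\<in>?V. (hit N m x * z ^ m) * (hit N n x * z ^ n))"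
    by (subst sum.swap[of _ ?C], subst sum.swap[of _ ?C]) (rule refl)
  also have "\<dots> = (\<Sum>x\<in>?C. (\<Sum>m\<in>?V. hit N m x * z ^ m) * (\<Sum>n\<in>?V. hit N n x * z ^ n))"
    by (simp add: sum_product)
  also have "\<dots> \<le> (\<Sum>x\<in>?C. (green N z x * ?\<chi>) * (green N z x * ?\<chi>))"
    using z susceptibility_pos[OF z, of N]
    by (intro sum_mono mult_mono hit_generating_le sum_nonneg
      mult_nonneg_nonneg hit_nonneg green_nonneg) auto
  also have "\<dots> = ?\<chi>\<^sup>2 * (\<Sum>x\<in>?C. (green N z x)\<^sup>2)"
    by (simp add: power2_eq_square sum_distrib_left mult_ac)
  also have "(\<Sum>m\<in>?V. \<Sum>n\<in>?V. saw_num N (m + n) * z ^ (m + n)) =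
      (\<Sum>n\<in>?V. \<Sum>i\<le>n. saw_num N (i + (n - i)) * z ^ (i + (n - i)))"
    by (rule triangle_sum_eq) (auto intro!: mult_nonneg_nonneg saw_num_nonneg simp: z saw_num_ge_vol)
  also have "\<dots> = (\<Sum>n<vol N. real (n + 1) * (saw_num N n * z ^ n))" by simp
  finally show ?thesis unfolding right_diff_distrib mult_1_right by linarith
qed

lemma shifted_sum_le:
  assumes "z \<ge> 0"
  shows "(\<Sum>n<vol N. saw_num N (m + n) * z ^ (m + n)) \<le> susceptibility N z"
proof -
  have "(\<Sum>n<vol N. saw_num N (m + n) * z ^ (m + n)) = (\<Sum>k\<in>{m..<m + vol N}. saw_num N k * z ^ k)"
    by (rule sum.reindex_bij_witness[where i = "\<lambda>k. k - m" and j = "\<lambda>n. m + n"]) auto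
  also have "\<dots> \<le> (\<Sum>k\<in>{..<m + vol N}. saw_num N k * z ^ k)"
    using assms by (intro sum_mono2) (auto intro!: mult_nonneg_nonneg saw_num_nonneg)
  also have "\<dots> = susceptibility N z" unfolding susceptibility_eq
    by (rule sum.mono_neutral_right) (auto simp: saw_num_ge_vol)
  finally show ?thesis .
qed

text \<open>
  A time scale \<open>m\<close> (about \<open>N\<^sup>5\<^sup>/\<^sup>4\<close>) long enough for the non-backtracking walk to mix and short enough
  for it to have probability at least 1/2 of being self-avoiding.
\<close>

definition good_scale :: "nat \<Rightarrow> nat \<Rightarrow> bool" where
  "good_scale N m \<longleftrightarrow> N \<ge> 7 \<and> m \<ge> 1 \<and> m ^ 2 \<le> N ^ 3 \<and> 116 * short_const * real m \<le> real N ^ 2 \<and>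
     real N * exp (- real m / (4 * (real N - 1))) \<le> 1 \<and>
     4800 * short_const / real N + 576 * real m / sqrt (real (vol N)) \<le> 1 / 3"

text \<open>The exponent \<open>5 / 4\<close> lies strictly between 1, as mixing takes a time of
  order \<open>N log N\<close>, and \<open>3 / 2\<close>, the limit set by
  \<open>m ^ 2 <= N ^ 3\<close>. Rounding up costs at most 1, hence the \<open>+ 1\<close> in the
  asymptotic estimates.\<close>

lemma exists_good_scale: "\<exists>N0. \<forall>N\<ge>N0. \<exists>m. good_scale N m"
proof -
  have 1: "\<forall>\<^sub>F N in sequentially. (real N powr (5/4) + 1)\<^sup>2 \<le> real N ^ 3" by real_asymp
  have 2: "\<forall>\<^sub>F N in sequentially. 116 * 20643840 * (real N powr (5/4) + 1) \<le> real N ^ 2" by real_asymp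
  have 3: "\<forall>\<^sub>F N in sequentially. real N * exp (- (real N powr (5/4)) / (4 * (real N - 1)))
    \<le> 1" by real_asymp
  have 4: "\<forall>\<^sub>F N in sequentially. 4800 * 20643840 / real N + 576 * (real N powr (5/4)
    + 1) / sqrt (2 ^ N) \<le> 1 / 3"
    by real_asymp
  have 5: "\<forall>\<^sub>F N in sequentially. N \<ge> 7" by (rule eventually_ge_at_top)
  have "\<forall>\<^sub>F N in sequentially. \<exists>m. good_scale N m"
    using 1 2 3 4 5
  proof eventually_elim
    case (elim N)
    define t where "t = real N powr (5/4)"
    define m where "m = nat \<lceil>t\<rceil>"
    have t: "t \<ge> 1" using elim(5) unfolding t_def by (intro ge_one_powr_ge_zero) auto
    have m: "t \<le> real m" "real m \<le> t + 1" using t unfolding m_def by linarith+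
    have "m \<ge> 1" using m t by linarith
    moreover have "m ^ 2 \<le> N ^ 3"
    proof -
      have "real m ^ 2 \<le> (t + 1)\<^sup>2" using m by (intro power_mono) auto
      also have "\<dots> \<le> real N ^ 3" using elim(1) by (simp add: t_def)
      finally have "real (m ^ 2) \<le> real (N ^ 3)" by simp
      then show ?thesis by (simp only: of_nat_le_iff)
    qed
    moreover have "116 * short_const * real m \<le> real N ^ 2"
    proof -
      have "116 * short_const * real m \<le> 116 * short_const * (t + 1)" using m
        by (intro mult_left_mono) (auto simp: short_const_def)
      then show ?thesis using elim(2) by (simp add: t_def short_const_def)
    qed
    moreover have "real N * exp (- real m / (4 * (real N - 1))) \<le> 1"
    proof -
      have "real N * exp (- real m / (4 * (real N - 1))) \<le> real N * exp (- t / (4 * (real N - 1)))"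
        using m elim(5) by (intro mult_left_mono) (auto intro!: divide_right_mono)
      then show ?thesis using elim(3) by (simp add: t_def)
    qed
    moreover have "4800 * short_const / real N + 576 * real m / sqrt (real (vol N)) \<le> 1 / 3"
    proof -
      have "576 * real m / sqrt (real (vol N)) \<le> 576 * (t + 1) / sqrt (real (vol N))"
        using m by (intro divide_right_mono mult_left_mono) auto
      moreover have "4800 * short_const / real N + 576 * (t + 1) / sqrt (real (vol N)) \<le> 1 / 3"
        using elim(4) by (simp add: t_def short_const_def vol_def)
      ultimately show ?thesis by linarith
    qed
    ultimately have "good_scale N m" using elim(5) by (simp add: good_scale_def)
    then show ?case ..
  qed
  then show ?thesis by (simp add: eventually_sequentially)
qed

section \<open>Bounds on \<open>c_m z^m\<close> and on the bubble at a good scale\<close>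

context
  fixes N m :: nat and p :: real
  assumes good: "good_scale N m"
  defines "p \<equiv> real N - 1"
begin

lemma good_scale_ge_7: "N \<ge> 7" and good_scale_degree_ge_6: "p \<ge> 6" and good_scale_pos: "m \<ge> 1"
  using good by (auto simp: good_scale_def p_def)

lemma saw_num_scale_lower: "p ^ m \<le> 2 * saw_num N m"
proof -
  have *: "116 * short_const * real m \<le> real N ^ 2" using good by (simp add: good_scale_def)
  have "1 * real m \<le> 116 * short_const * real m" by (intro mult_right_mono) (auto simp: short_const_def)
  then have "real m \<le> real (N ^ 2)" using * unfolding of_nat_power by linarith
  then have "m \<le> N ^ 2" by (simp only: of_nat_le_iff)
  then have low: "(1 - 58 * short_const * real m / real N ^ 2) * p ^ m \<le> saw_num N m"
    unfolding p_def using saw_num_lower[of N m] good_scale_ge_7 by simp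
  have "58 * short_const * real m / real N ^ 2 \<le> 1 / 2" using * good_scale_ge_7
    by (simp add: pos_divide_le_eq)
  then have "(1 / 2) * p ^ m \<le> (1 - 58 * short_const * real m / real N ^ 2) * p ^ m"
    using good_scale_degree_ge_6 by (intro mult_right_mono) auto
  then show ?thesis using low by simp
qed

text \<open>The hypothesis gives \<open>(p * z) ^ i <= 6\<close> for all \<open>i <= m\<close>, so
  the short part is at most 6 times its value at \<open>1 / p\<close>. For the rest, the first
  \<open>m\<close> steps end at a given point in at most
  \<open>12 * p ^ m / V <= 24 * c_m / V\<close> ways, and \<open>c_m z^m <= 3\<close> turns 24 into
  72.\<close>

lemma green_bound:
  assumes z: "z \<ge> 0" "saw_num N m * z ^ m \<le> 3" and x: "x \<noteq> 0"
  shows "green N z x \<le> 6 * green_short N m x + 72 * susceptibility N z / real (vol N)"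
proof -
  let ?\<chi> = "susceptibility N z"
  have zp: "(p * z) ^ m \<le> 6"
  proof -
    have "(p * z) ^ m \<le> 2 * saw_num N m * z ^ m"
      unfolding power_mult_distrib using z saw_num_scale_lower by (intro mult_right_mono) auto
    then show ?thesis using z by simp
  qed
  have zpi: "(p * z) ^ i \<le> 6" if "i \<le> m" for i
  proof (cases "p * z \<le> 1")
    case True
    then have "(p * z) ^ i \<le> 1" using z good_scale_degree_ge_6 by (intro power_le_one) auto
    then show ?thesis by simp
  next
    case False
    then have "(p * z) ^ i \<le> (p * z) ^ m" using that by (intro power_increasing) auto
    then show ?thesis using zp by simp
  qed
  \<comment> \<open>The range is extended by \<open>m\<close> terms so that the part from
    \<open>m\<close> on is again indexed by \<open>n < vol N\<close>.\<close>
  have "green N z x \<le> (\<Sum>n<m + vol N. saw_num_to N n x * z ^ n)"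
    unfolding green_def using z by (intro sum_mono2) (auto intro!: mult_nonneg_nonneg saw_num_to_nonneg)
  also have "\<dots> = (\<Sum>n<m. saw_num_to N n x * z ^ n) + (\<Sum>n\<in>{m..<m + vol N}. saw_num_to N n x * z ^ n)"
    by (subst sum.union_disjoint[symmetric]) (auto intro: sum.cong)
  also have "(\<Sum>n<m. saw_num_to N n x * z ^ n) = (\<Sum>n\<in>{1..<m}. saw_num_to N n x * z ^ n)"
    using x by (intro sum.mono_neutral_right) (auto simp: saw_num_to_0 not_less_eq_eq)
  also have "\<dots> \<le> (\<Sum>n\<in>{1..m}. saw_num_to N n x * z ^ n)"
    using z by (intro sum_mono2) (auto intro!: mult_nonneg_nonneg saw_num_to_nonneg)
  also have "\<dots> \<le> (\<Sum>n\<in>{1..m}. 6 * (saw_num_to N n x / p ^ n))"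
  proof (rule sum_mono)
    fix n assume n: "n \<in> {1..m}"
    have "saw_num_to N n x * z ^ n = saw_num_to N n x / p ^ n * (p * z) ^ n"
      using good_scale_degree_ge_6 by (simp add: power_mult_distrib)
    also have "\<dots> \<le> saw_num_to N n x / p ^ n * 6"
      using n good_scale_degree_ge_6
        by (intro mult_left_mono zpi divide_nonneg_nonneg saw_num_to_nonneg) auto
    finally show "saw_num_to N n x * z ^ n \<le> 6 * (saw_num_to N n x / p ^ n)" by (simp only: mult.commute)
  qed
  also have "\<dots> = 6 * green_short N m x"
    by (simp add: green_short_def p_def sum_distrib_left)
  also have "(\<Sum>n\<in>{m..<m + vol N}. saw_num_to N n x * z ^ n) = (\<Sum>n<vol N. saw_num_to N (m
    + n) x * z ^ (m + n))"
    by (rule sum.reindex_bij_witness[where j = "\<lambda>k. k - m" and i = "\<lambda>n. m + n"]) auto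
  also have "\<dots> \<le> (\<Sum>n<vol N. 72 / real (vol N) * (saw_num N n * z ^ n))"
  proof (rule sum_mono)
    fix n
    have "saw_num_to N (m + n) x \<le> (\<Sum>y\<in>cube N. saw_num_to N m y * saw_num_to N n (x - y))"
      by (rule saw_num_to_submult)
    also have "\<dots> \<le> (\<Sum>y\<in>cube N. 12 * p ^ m / real (vol N) * saw_num_to N n (x - y))"
      unfolding p_def using good good_scale_pos good_scale_ge_7
      by (intro sum_mono mult_right_mono saw_num_to_uniform_bound saw_num_to_nonneg) (auto
        simp: good_scale_def)
    also have "\<dots> = 12 * p ^ m / real (vol N) * (\<Sum>y\<in>cube N. saw_num_to N n (x - y))"
      by (simp only: sum_distrib_left)
    also have "\<dots> \<le> 12 * p ^ m / real (vol N) * saw_num N n"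
    proof (rule mult_left_mono)
      show "(\<Sum>y\<in>cube N. saw_num_to N n (x - y)) \<le> saw_num N n"
      proof (cases "x \<in> cube N")
        case True
        have "(\<Sum>y\<in>cube N. saw_num_to N n (x - y)) = (\<Sum>y\<in>cube N. saw_num_to N n (y + x))"
          by (simp only: minus_eq_plus add.commute)
        then show ?thesis using sum_cube_translate[OF True, of "saw_num_to N n"]
          by (simp add: saw_num_eq_sum)
      next
        case False
        have "saw_num_to N n (x - y) = 0" if "y \<in> cube N" for y
        proof (rule saw_num_to_outside)
          show "x - y \<notin> cube N"
          proof
            assume "x - y \<in> cube N"
            from cube_add[OF this that] show False using False by simp
          qed
        qed
        then show ?thesis by (simp add: saw_num_nonneg)
      qed
    qed (use good_scale_degree_ge_6 in simp)
    also have "\<dots> \<le> 12 * (2 * saw_num N m) / real (vol N) * saw_num N n"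
      by (intro mult_right_mono divide_right_mono mult_left_mono saw_num_scale_lower saw_num_nonneg) auto
    finally have "saw_num_to N (m + n) x * z ^ (m + n)
      \<le> 12 * (2 * saw_num N m) / real (vol N) * saw_num N n * z ^ (m + n)"
      using z by (intro mult_right_mono) auto
    also have "\<dots> = 24 / real (vol N) * (saw_num N n * z ^ n) * (saw_num N m * z ^ m)"
      by (simp add: power_add)
    also have "\<dots> \<le> 24 / real (vol N) * (saw_num N n * z ^ n) * 3"
      using z by (intro mult_left_mono mult_nonneg_nonneg saw_num_nonneg) auto
    finally show "saw_num_to N (m + n) x * z ^ (m + n)
      \<le> 72 / real (vol N) * (saw_num N n * z ^ n)" by simp
  qed
  also have "\<dots> = 72 * ?\<chi> / real (vol N)" unfolding susceptibility_eq sum_distrib_left[symmetric] by simp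
  finally show ?thesis by simp
qed

text \<open>The upper and lower bounds on the counts combine to
  \<open>c_(m-i) <= 2 * p ^ (m - i) <= 4 * c_m / p ^ i\<close>.\<close>

lemma hit_scale_le:
  assumes x: "x \<noteq> 0"
  shows "hit N m x \<le> 4 * saw_num N m * green_short N m x"
proof -
  have "hit N m x = (\<Sum>i\<in>{1..m}. saw_num_to N i x * saw_num N (m - i))"
    unfolding hit_def using x by (intro sum.mono_neutral_right) (auto simp: saw_num_to_0 not_less_eq_eq)
  also have "\<dots> \<le> (\<Sum>i\<in>{1..m}. 4 * saw_num N m * (saw_num_to N i x / p ^ i))"
  proof (rule sum_mono)
    fix i assume i: "i \<in> {1..m}"
    have "saw_num N (m - i) \<le> 2 * p ^ (m - i)" unfolding p_def using good_scale_ge_7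
      by (intro saw_num_le) simp
    also have "p ^ (m - i) = p ^ m / p ^ i" using i good_scale_degree_ge_6 by (simp add: power_diff)
    also have "2 * (p ^ m / p ^ i) \<le> 2 * ((2 * saw_num N m) / p ^ i)"
      using good_scale_degree_ge_6 by (intro mult_left_mono divide_right_mono saw_num_scale_lower) auto
    finally have "saw_num_to N i x * saw_num N (m - i)
      \<le> saw_num_to N i x * (2 * ((2 * saw_num N m) / p ^ i))"
      by (intro mult_left_mono saw_num_to_nonneg)
    then show "saw_num_to N i x * saw_num N (m - i) \<le> 4 * saw_num N m * (saw_num_to N i x / p ^ i)"
      by (simp add: mult_ac)
  qed
  also have "\<dots> = 4 * saw_num N m * green_short N m x"
    by (simp add: green_short_def p_def sum_distrib_left)
  finally show ?thesis .
qed

text \<open>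
  A walk of length \<open>m\<close> avoids an independent walk weighted by \<open>z\<close> with probability at least 2/3, so
  \<open>2/3 * c_m z^m * chi <= \<Sum>\<^sub>n c_(m+n) z^(m+n) <= chi\<close>.
\<close>

lemma bootstrap:
  assumes z: "z \<ge> 0" "saw_num N m * z ^ m \<le> 3" and chi: "susceptibility N z \<le> sqrt (real (vol N))"
  shows "saw_num N m * z ^ m \<le> 3 / 2"
proof -
  let ?\<chi> = "susceptibility N z" and ?C = "cube N - {0}"
  let ?Q = "green_short N m"
  \<comment> \<open>The two numerators come from the cross term below:
    \<open>4 * 6 * 200 = 4800\<close> and \<open>4 * 72 * 2 = 576\<close>.\<close>
  define \<delta> where "\<delta> = 4800 * short_const / real N + 576 * real m / sqrt (real (vol N))"
  have \<chi>: "?\<chi> > 0" by (rule susceptibility_pos[OF z(1)])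
  have N2: "N \<ge> 2" using good_scale_ge_7 by simp
  have V: "real (vol N) > 0" using vol_pos by simp
  have "?\<chi> / real (vol N) \<le> sqrt (real (vol N)) / real (vol N)"
    using chi by (intro divide_right_mono) auto
  also have "\<dots> = 1 / sqrt (real (vol N))" using V by (simp add: field_simps)
  finally have \<chi>V: "?\<chi> / real (vol N) \<le> 1 / sqrt (real (vol N))" .
  have "(\<Sum>x\<in>?C. hit N m x * green N z x) \<le> (\<Sum>x\<in>?C. 4 * saw_num N m * ?Q x * (6 * ?Q x
    + 72 * ?\<chi> / real (vol N)))"
    using z by (intro sum_mono mult_mono hit_scale_le green_bound mult_nonneg_nonneg green_nonneg
       green_short_nonneg N2 saw_num_nonneg) auto
  also have "\<dots> \<le> (\<Sum>x\<in>cube N. 4 * saw_num N m * ?Q x * (6 * ?Q x + 72 * ?\<chi> / real (vol N)))"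
    using \<chi> by (intro sum_mono2 finite_cube) (auto intro!: mult_nonneg_nonneg add_nonneg_nonneg
      divide_nonneg_nonneg green_short_nonneg N2 saw_num_nonneg)
  also have "\<dots> = (\<Sum>x\<in>cube N. 4 * saw_num N m * (6 * (?Q x)\<^sup>2 + 72 * (?\<chi> / real (vol N)) * ?Q x))"
    by (intro sum.cong refl) (simp add: algebra_simps power2_eq_square)
  also have "\<dots> = 4 * saw_num N m * (6 * (\<Sum>x\<in>cube N. (?Q x)\<^sup>2)
    + 72 * (?\<chi> / real (vol N)) * (\<Sum>x\<in>cube N. ?Q x))"
    by (simp only: sum_distrib_left[symmetric] sum.distrib)
  also have "\<dots> \<le> 4 * saw_num N m * (6 * (200 * short_const / real N)
    + 72 * (1 / sqrt (real (vol N))) * (2 * real m))"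
    using good \<chi>
    by (intro mult_left_mono add_mono mult_mono order_refl \<chi>V green_short_square_sum green_short_sum N2 mult_nonneg_nonneg
       sum_nonneg green_short_nonneg saw_num_nonneg) (auto simp: good_scale_def)
  also have "\<dots> = saw_num N m * \<delta>" by (simp add: \<delta>_def algebra_simps)
  finally have cross: "(\<Sum>x\<in>?C. hit N m x * green N z x) \<le> saw_num N m * \<delta>" .
  have "saw_num N m * z ^ m * ?\<chi> = (\<Sum>n<vol N. (saw_num N m * z ^ m) * (saw_num N n * z ^ n))"
    by (simp add: susceptibility_eq sum_distrib_left)
  also have "\<dots> \<le> (\<Sum>n<vol N. saw_num N (m + n) * z ^ (m + n)
    + (\<Sum>x\<in>?C. hit N m x * z ^ m * (hit N n x * z ^ n)))"
    by (intro sum_mono saw_num_supermult_weighted z)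
  also have "\<dots> = (\<Sum>n<vol N. saw_num N (m + n) * z ^ (m + n))
    + (\<Sum>n<vol N. \<Sum>x\<in>?C. hit N m x * z ^ m * (hit N n x * z ^ n))"
    by (rule sum.distrib)
  also have "(\<Sum>n<vol N. \<Sum>x\<in>?C. hit N m x * z ^ m * (hit N n x * z ^ n)) =
     (\<Sum>x\<in>?C. hit N m x * z ^ m * (\<Sum>n<vol N. hit N n x * z ^ n))"
    by (subst sum.swap) (simp add: sum_distrib_left)
  also have "\<dots> \<le> (\<Sum>x\<in>?C. hit N m x * z ^ m * (green N z x * ?\<chi>))"
    using z by (intro sum_mono mult_left_mono hit_generating_le mult_nonneg_nonneg hit_nonneg) auto
  also have "\<dots> = z ^ m * ?\<chi> * (\<Sum>x\<in>?C. hit N m x * green N z x)"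
    by (simp add: sum_distrib_left mult_ac)
  also have "\<dots> \<le> z ^ m * ?\<chi> * (saw_num N m * \<delta>)"
    using z \<chi> by (intro mult_left_mono cross) auto
  also have "(\<Sum>n<vol N. saw_num N (m + n) * z ^ (m + n)) \<le> ?\<chi>" by (rule shifted_sum_le[OF z(1)])
  finally have "?\<chi> * (saw_num N m * z ^ m) \<le> ?\<chi> * (1 + saw_num N m * z ^ m * \<delta>)"
    by (simp add: algebra_simps)
  \<comment> \<open>After division by chi, the quantity \<open>u = c_m z^m\<close> satisfies
    \<open>u <= 1 + u / 3\<close>.\<close>
  then have "saw_num N m * z ^ m \<le> 1 + saw_num N m * z ^ m * \<delta>" using \<chi> by simp
  also have "\<dots> \<le> 1 + saw_num N m * z ^ m * (1 / 3)"
    using good z by (intro add_mono mult_left_mono mult_nonneg_nonneg saw_num_nonneg) (auto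
      simp: good_scale_def \<delta>_def)
  finally show ?thesis by simp
qed

text \<open>By \<open>bootstrap\<close> the values above \<open>3 / 2\<close> and up to 3 cannot
  occur while chi stays below \<open>sqrt V\<close>; since chi is increasing, a continuous path from
  0 to \<open>z\<close> cannot cross this gap.\<close>

lemma scale_bound:
  assumes z: "z \<ge> 0" and chi: "susceptibility N z \<le> sqrt (real (vol N))"
  shows "saw_num N m * z ^ m \<le> 3"
proof (rule ccontr)
  assume neg: "\<not> ?thesis"
  have "\<exists>y\<ge>0. y \<le> z \<and> saw_num N m * y ^ m = 3"
  proof (rule IVT')
    show "saw_num N m * 0 ^ m \<le> 3" using good_scale_pos by (simp add: power_0_left)
    show "3 \<le> saw_num N m * z ^ m" using neg by simp
    show "continuous_on {0..z} (\<lambda>y. saw_num N m * y ^ m)" by (intro continuous_intros)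
  qed (rule z)
  then obtain y where y: "y \<ge> 0" "y \<le> z" "saw_num N m * y ^ m = 3" by blast
  have "susceptibility N y \<le> susceptibility N z"
    using susceptibility_ge[of N y z] good_scale_ge_7 y by simp
  then have "saw_num N m * y ^ m \<le> 3 / 2" using chi y by (intro bootstrap) auto
  then show False using y by simp
qed

text \<open>The square of \<open>green_bound\<close> is split into
  \<open>72 * Q^2 + 2 * c^2\<close>. The first part sums to order \<open>1 / N\<close>; the constant
  part, summed over all \<open>V\<close> points, is of order
  \<open>chi^2 / V <= lam^2\<close>.\<close>

lemma bubble_bound:
  assumes z: "z \<ge> 0" and chi: "susceptibility N z \<le> lam * sqrt (real (vol N))" and lam: "0 \<le> lam" "lam
    \<le> 1"
  shows "(\<Sum>x\<in>cube N - {0}. (green N z x)\<^sup>2) \<le> 14400 * short_const * (1 / real N + lam\<^sup>2)"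
proof -
  let ?\<chi> = "susceptibility N z" and ?C = "cube N - {0}"
  let ?Q = "green_short N m"
  have N2: "N \<ge> 2" using good_scale_ge_7 by simp
  have V: "real (vol N) > 0" using vol_pos by simp
  have \<chi>: "?\<chi> > 0" by (rule susceptibility_pos[OF z])
  have "lam * sqrt (real (vol N)) \<le> 1 * sqrt (real (vol N))" using lam by (intro mult_right_mono) auto
  then have "saw_num N m * z ^ m \<le> 3" using chi z by (intro scale_bound) auto
  note gb = green_bound[OF z this]
  define c where "c = 72 * ?\<chi> / real (vol N)"
  have c: "c \<ge> 0" using \<chi> by (simp add: c_def)
  have "(\<Sum>x\<in>?C. (green N z x)\<^sup>2) \<le> (\<Sum>x\<in>?C. 72 * (?Q x)\<^sup>2 + 2 * c\<^sup>2)"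
  proof (rule sum_mono)
    fix x assume "x \<in> ?C"
    then have "(green N z x)\<^sup>2 \<le> (6 * ?Q x + c)\<^sup>2"
      unfolding c_def using gb[of x] by (intro power_mono green_nonneg z) auto
    also have "\<dots> \<le> 72 * (?Q x)\<^sup>2 + 2 * c\<^sup>2"
      using zero_le_power2[of "6 * ?Q x - c"] by (simp add: power2_eq_square algebra_simps)
    finally show "(green N z x)\<^sup>2 \<le> 72 * (?Q x)\<^sup>2 + 2 * c\<^sup>2" .
  qed
  also have "\<dots> \<le> (\<Sum>x\<in>cube N. 72 * (?Q x)\<^sup>2 + 2 * c\<^sup>2)"
    by (intro sum_mono2 finite_cube) auto
  also have "\<dots> = 72 * (\<Sum>x\<in>cube N. (?Q x)\<^sup>2) + real (vol N) * (2 * c\<^sup>2)"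
    by (simp add: sum.distrib sum_distrib_left card_cube)
  also have "\<dots> \<le> 72 * (200 * short_const / real N)
    + real (vol N) * (2 * (72 * lam / sqrt (real (vol N)))\<^sup>2)"
  proof (intro add_mono mult_left_mono power_mono)
    show "(\<Sum>x\<in>cube N. (?Q x)\<^sup>2) \<le> 200 * short_const / real N"
      using good N2 by (intro green_short_square_sum) (auto simp: good_scale_def)
    have "c \<le> 72 * (lam * sqrt (real (vol N))) / real (vol N)"
      unfolding c_def using chi by (intro divide_right_mono) auto
    also have "\<dots> = 72 * lam / sqrt (real (vol N))" using V by (simp add: field_simps)
    finally show "c \<le> 72 * lam / sqrt (real (vol N))" .
  qed (use c in auto)
  also have "real (vol N) * (2 * (72 * lam / sqrt (real (vol N)))\<^sup>2) = 10368 * lam\<^sup>2"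
    using V by (simp add: power_divide power_mult_distrib)
  also have "72 * (200 * short_const / real N) = 14400 * short_const * (1 / real N)" by simp
  finally have "(\<Sum>x\<in>?C. (green N z x)\<^sup>2) \<le> 14400 * short_const * (1 / real N) + 10368 * lam\<^sup>2" .
  moreover have "10368 * lam\<^sup>2 \<le> 14400 * short_const * lam\<^sup>2"
    by (intro mult_right_mono) (auto simp: short_const_def)
  ultimately show ?thesis unfolding distrib_left by linarith
qed

end

section \<open>From the bubble to the expected length\<close>

lemma expected_length_le:
  assumes "z \<ge> 0"
  shows "expected_length N z \<le> susceptibility N z"
proof -
  have "{0..vol N - 1} = {..<vol N}" using vol_pos[of N] by auto
  then have "expected_length N z = (\<Sum>n<vol N. real (n + 1) * (saw_num N n * z ^ n)) / susceptibility N z"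
    by (simp add: expected_length_sum[OF assms] saw_num_def)
  also have "\<dots> \<le> (susceptibility N z)\<^sup>2 / susceptibility N z"
    using susceptibility_pos[OF assms, of N] by (intro divide_right_mono length_sum_le assms) auto
  finally show ?thesis by (simp add: power2_eq_square)
qed

lemma expected_length_ge:
  assumes "z \<ge> 0"
  shows "susceptibility N z * (1 - (\<Sum>x\<in>cube N - {0}. (green N z x)\<^sup>2)) \<le> expected_length N z"
proof -
  have "{0..vol N - 1} = {..<vol N}" using vol_pos[of N] by auto
  then have E: "expected_length N z = (\<Sum>n<vol N. real (n
    + 1) * (saw_num N n * z ^ n)) / susceptibility N z"
    by (simp add: expected_length_sum[OF assms] saw_num_def)
  have "(susceptibility N z)\<^sup>2 * (1 - (\<Sum>x\<in>cube N - {0}. (green N z x)\<^sup>2)) / susceptibility N z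
    \<le> expected_length N z"
    unfolding E using susceptibility_pos[OF assms, of N]
      by (intro divide_right_mono length_sum_ge assms) auto
  then show ?thesis using susceptibility_pos[OF assms, of N] by (simp add: power2_eq_square)
qed

lemma expected_length_nonneg: "expected_length N z \<ge> 0"
  unfolding expected_length_def by (intro integral_nonneg_AE) simp

theorem theorem1p5:
  shows "\<exists>lam0::real. lam0 > 0 \<and> (\<exists>C::real. \<forall>lam\<in>{0<..lam0}. \<forall>N::nat.
    N \<ge> 1 \<and> lam * sqrt (real (vol N)) > 1 \<longrightarrow>
    (let \<beta> = 1 / real N + lam\<^sup>2 in
      (\<forall>z\<in>{0..z_crit N lam}.
         (\<exists>\<epsilon>::real. \<bar>\<epsilon>\<bar> \<le> C * \<beta> \<and>
            (1 - \<epsilon>) * susceptibility N z \<le> expected_length N z) \<and>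
         expected_length N z \<le> susceptibility N z) \<and>
      (\<exists>\<epsilon>::real. \<bar>\<epsilon>\<bar> \<le> C * \<beta> \<and>
         expected_length N (z_crit N lam) = lam * sqrt (real (vol N)) * (1 + \<epsilon>))))"
proof -
  obtain N0 where N0: "\<And>N. N \<ge> N0 \<Longrightarrow> \<exists>m. good_scale N m" using exists_good_scale by blast
  \<comment> \<open>The summand \<open>N0\<close> covers the finitely many small \<open>N\<close>:
    for \<open>N < N0\<close> it makes \<open>C * \<beta>\<close> at least 1, so the lower bound is
    not positive and holds trivially.\<close>
  define C where "C = 14400 * short_const + real N0"
  have lower: "(1 - C * (1 / real N + lam\<^sup>2)) * susceptibility N z \<le> expected_length N z"
    if lam: "lam \<in> {0<..1}" and N: "N \<ge> 1" and z: "z \<ge> 0"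
      and chi: "susceptibility N z \<le> lam * sqrt (real (vol N))" for lam N z
  proof (cases "N \<ge> N0")
    case True
    then obtain m where m: "good_scale N m" using N0 by blast
    have \<beta>: "1 / real N + lam\<^sup>2 \<ge> 0" by simp
    have "(\<Sum>x\<in>cube N - {0}. (green N z x)\<^sup>2) \<le> 14400 * short_const * (1 / real N + lam\<^sup>2)"
      using bubble_bound[OF m z chi] lam by simp
    also have "\<dots> \<le> C * (1 / real N + lam\<^sup>2)"
      using \<beta> by (intro mult_right_mono) (auto simp: C_def)
    finally have "susceptibility N z * (1 - C * (1 / real N + lam\<^sup>2)) \<le>
      susceptibility N z * (1 - (\<Sum>x\<in>cube N - {0}. (green N z x)\<^sup>2))"
      using susceptibility_pos[OF z, of N] by (intro mult_left_mono) auto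
    also have "\<dots> \<le> expected_length N z" by (rule expected_length_ge[OF z])
    finally show ?thesis by (simp add: mult.commute)
  next
    case False
    have "1 \<le> real N0 * (1 / real N)" using False N by (simp add: field_simps)
    also have "\<dots> \<le> C * (1 / real N + lam\<^sup>2)" by (intro mult_mono) (auto simp: C_def short_const_def)
    finally have "(1 - C * (1 / real N + lam\<^sup>2)) * susceptibility N z \<le> 0"
      using susceptibility_pos[OF z, of N] by (intro mult_nonpos_nonneg) auto
    then show ?thesis using expected_length_nonneg[of N z] by linarith
  qed
  have "\<forall>lam\<in>{0<..1}. \<forall>N::nat.
    N \<ge> 1 \<and> lam * sqrt (real (vol N)) > 1 \<longrightarrow>
    (let \<beta> = 1 / real N + lam\<^sup>2 in
      (\<forall>z\<in>{0..z_crit N lam}.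
         (\<exists>\<epsilon>::real. \<bar>\<epsilon>\<bar> \<le> C * \<beta> \<and>
            (1 - \<epsilon>) * susceptibility N z \<le> expected_length N z) \<and>
         expected_length N z \<le> susceptibility N z) \<and>
      (\<exists>\<epsilon>::real. \<bar>\<epsilon>\<bar> \<le> C * \<beta> \<and>
         expected_length N (z_crit N lam) = lam * sqrt (real (vol N)) * (1 + \<epsilon>)))"
    unfolding Let_def
  proof (intro ballI allI impI conjI; (elim conjE)?)
    fix lam :: real and N :: nat
    assume lam: "lam \<in> {0<..1}" and N: "1 \<le> N" and big: "1 < lam * sqrt (real (vol N))"
    define \<beta> where "\<beta> = 1 / real N + lam\<^sup>2"
    define zc where "zc = z_crit N lam"
    have C\<beta>: "C * \<beta> \<ge> 0" by (intro mult_nonneg_nonneg) (auto simp: C_def short_const_def \<beta>_def)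
    have zc: "zc > 0" "susceptibility N zc = lam * sqrt (real (vol N))"
      using theI'[OF z_crit_ex1[of N lam]] N big unfolding zc_def z_crit_def by auto
    {
      fix z assume z: "z \<in> {0..z_crit N lam}"
      have "susceptibility N z \<le> lam * sqrt (real (vol N))"
        using susceptibility_ge[of N z zc] z zc N by (simp add: zc_def)
      then have "(1 - C * \<beta>) * susceptibility N z \<le> expected_length N z"
        unfolding \<beta>_def using z by (intro lower lam N) auto
      moreover have "\<bar>C * \<beta>\<bar> \<le> C * \<beta>" using C\<beta> by simp
      ultimately show "\<exists>\<epsilon>. \<bar>\<epsilon>\<bar> \<le> C * (1 / real N + lam\<^sup>2) \<and>
          (1 - \<epsilon>) * susceptibility N z \<le> expected_length N z"
        unfolding \<beta>_def by blast
      show "expected_length N z \<le> susceptibility N z" using z by (intro expected_length_le) simp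
    }
    define S where "S = lam * sqrt (real (vol N))"
    define \<epsilon> where "\<epsilon> = expected_length N zc / S - 1"
    have S: "S > 0" using big by (simp add: S_def)
    have low: "(1 - C * \<beta>) * S \<le> expected_length N zc"
      using lower[OF lam N, of zc] zc by (simp add: S_def \<beta>_def)
    have up: "expected_length N zc \<le> S" using expected_length_le[of zc N] zc by (simp add: S_def)
    have "expected_length N zc = S * (1 + \<epsilon>)" using S by (simp add: \<epsilon>_def)
    moreover have "\<bar>\<epsilon>\<bar> \<le> C * \<beta>"
    proof -
      have "1 - C * \<beta> \<le> expected_length N zc / S" using low S by (simp add: pos_le_divide_eq)
      moreover have "expected_length N zc / S \<le> 1" using up S by simp
      ultimately show ?thesis unfolding \<epsilon>_def using C\<beta> by linarith
    qed
    ultimately show "\<exists>\<epsilon>. \<bar>\<epsilon>\<bar> \<le> C * (1 / real N + lam\<^sup>2) \<and>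
        expected_length N (z_crit N lam) = lam * sqrt (real (vol N)) * (1 + \<epsilon>)"
      unfolding S_def \<beta>_def zc_def by blast
  qed
  \<comment> \<open>The bootstrap only asks for chi to be at most \<open>sqrt V\<close>, so
    \<open>lam0 = 1\<close> is admissible.\<close>
  then show ?thesis by (intro exI[of _ "1::real"] conjI exI[of _ C]) auto
qed

end
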